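(* Let $K$ be a perfect field of prime characteristic $p>0$, let $n,d\ge 1$ be integers, and let $S^{(d)}$ be the $d$-th Veronese subring of the polynomial ring $S=K[x_1,\dots,x_n]$. Then the dual $F$-signature of $S^{(d)}$ is $$s_{dual}\left(S^{(d)}\right)=\frac{1}{n}\left\lceil\frac{n}{d}\right\rceil .$$
   Context: $S=K[x_1,\dots,x_n]$ carries the standard grading, $S_i$ denotes its $i$-th homogeneous component (so $S_i=0$ for $i<0$), and $S^{(d)}=\bigoplus_{i\ge 0}S_{id}$ is the $d$-th Veronese subring. It is a Cohen–Macaulay domain of dimension $n$ with canonical module $$\omega_{S^{(d)}}=(S(-n))^{(d)}=\bigoplus_{i\in\mathbb Z}S_{id-n},$$ regarded as an $S^{(d)}$-module by multiplication inside $S$. For an $S^{(d)}$-module $M$ and $e\ge 1$, $F^e_*M$ denotes $M$ with the $S^{(d)}$-module structure obtained by restriction of scalars along the $e$-th iterate of the Frobenius endomorphism of $S^{(d)}$ (so $r$ acts as multiplication by $r^{p^e}$); for $M\subseteq S$ it is identified with the module $M^{1/p^e}$ of $p^e$-th roots of elements of $M$. Let $b_e$ be the largest integer $N\ge 0$ for which there exists a surjective $S^{(d)}$-linear map $F^e_*\omega_{S^{(d)}}\twoheadrightarrow \omega_{S^{(d)}}^{\oplus N}$. The dual $F$-signature of the ring $S^{(d)}$ means the dual $F$-signature of its canonical module: $$s_{dual}\left(S^{(d)}\right)=\limsup_{e\to\infty}\frac{b_e}{\operatorname{rank}_{S^{(d)}}F^e_*\omega_{S^{(d)}}}=\limsup_{e\to\infty}\frac{b_e}{p^{en}}.$$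 *)

theory Defs
  imports
    "HOL-Library.Extended_Real"
    "HOL-Library.Liminf_Limsup"
    "HOL-Algebra.Algebraic_Closure_Type"
    "Jordan_Normal_Form.Missing_VectorSpace"
    "HOL-Library.Poly_Mapping"
begin

section \<open>Modules and the dual F-signature\<close>

definition direct_power :: "nat \<Rightarrow> ('a, 'b, 'm) module_scheme \<Rightarrow> ('a, nat \<Rightarrow> 'b) module" where
  "direct_power N M =
     \<lparr>carrier = (\<Pi>\<^sub>E i\<in>{..<N}. carrier M),
      monoid.mult = (\<lambda>x y. \<lambda>i\<in>{..<N}. x i \<otimes>\<^bsub>M\<^esub> y i),
      one = (\<lambda>i\<in>{..<N}. \<one>\<^bsub>M\<^esub>),
      ring.zero = (\<lambda>i\<in>{..<N}. \<zero>\<^bsub>M\<^esub>),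
      add = (\<lambda>x y. \<lambda>i\<in>{..<N}. x i \<oplus>\<^bsub>M\<^esub> y i),
      module.smult = (\<lambda>r x. \<lambda>i\<in>{..<N}. r \<odot>\<^bsub>M\<^esub> x i)\<rparr>"

definition frobenius_pushforward ::
  "('a, 'r) ring_scheme \<Rightarrow> nat \<Rightarrow> nat \<Rightarrow> ('a, 'b, 'm) module_scheme \<Rightarrow> ('a, 'b, 'm) module_scheme" where
  "frobenius_pushforward R p e M = M\<lparr>module.smult := (\<lambda>r m. (r [^]\<^bsub>R\<^esub> (p ^ e)) \<odot>\<^bsub>M\<^esub> m)\<rparr>"

text \<open>
  The rank of a module over a domain \<open>R\<close>, i.e. the dimension of its base change to the fraction
  field of \<open>R\<close>, as the largest number of \<open>R\<close>-linearly independent elements.  \<open>GREATEST\<close> is only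
  meaningful for modules of finite rank.
\<close>

definition module_rank :: "('a, 'r) ring_scheme \<Rightarrow> ('a, 'b, 'm) module_scheme \<Rightarrow> nat" where
  "module_rank R M =
     (GREATEST k. \<exists>B. finite B \<and> B \<subseteq> carrier M \<and> \<not> module.lin_dep R M B \<and> card B = k)"

definition max_surjection_rank ::
  "('a, 'r) ring_scheme \<Rightarrow> ('a, 'b, 'm) module_scheme \<Rightarrow> ('a, 'c, 'l) module_scheme \<Rightarrow> nat" where
  "max_surjection_rank R M' M =
     (GREATEST N. \<exists>\<phi> \<in> LinearCombinations.module_hom R M' (direct_power N M).
        \<phi> ` carrier M' = carrier (direct_power N M))"

text \<open>Here \<open>R\<close> is meant to be a domain of characteristic \<open>p\<close>.\<close>

definition dual_F_signature ::
  "('a, 'r) ring_scheme \<Rightarrow> nat \<Rightarrow> ('a, 'b, 'm) module_scheme \<Rightarrow> ereal" where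
  "dual_F_signature R p M =
     limsup (\<lambda>e. ereal (real (max_surjection_rank R (frobenius_pushforward R p e M) M)
                        / real (module_rank R (frobenius_pushforward R p e M))))"


section \<open>Veronese subrings of polynomial rings\<close>

text \<open>
  A polynomial over \<open>'k\<close> is a finitely supported function on monomials, and a monomial is a finitely
  supported exponent function; multiplication of \<open>poly_mapping\<close> is convolution.  The variables
  \<open>x\<^sub>1, \<dots>, x\<^sub>n\<close> are those with index below \<open>n\<close>.
\<close>

type_synonym 'k mpoly = "(nat \<Rightarrow>\<^sub>0 nat) \<Rightarrow>\<^sub>0 'k"

definition polynomials :: "nat \<Rightarrow> 'k::zero mpoly set" where
  "polynomials n = {f. \<forall>m \<in> Poly_Mapping.keys f. Poly_Mapping.keys m \<subseteq> {..<n}}"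

definition monomial_degree :: "(nat \<Rightarrow>\<^sub>0 nat) \<Rightarrow> nat" where
  "monomial_degree m = (\<Sum>i\<in>Poly_Mapping.keys m. Poly_Mapping.lookup m i)"

definition homogeneous_component :: "nat \<Rightarrow> int \<Rightarrow> 'k::zero mpoly set" where
  "homogeneous_component n i =
     {f \<in> polynomials n. \<forall>m \<in> Poly_Mapping.keys f. int (monomial_degree m) = i}"

text \<open>The internal sum of the family \<open>A\<close> of additive subgroups over the index set \<open>I\<close>.\<close>

definition internal_sum :: "'i set \<Rightarrow> ('i \<Rightarrow> 'a::comm_monoid_add set) \<Rightarrow> 'a set" where
  "internal_sum I A = {\<Sum>i\<in>J. g i | J g. finite J \<and> J \<subseteq> I \<and> (\<forall>i\<in>J. g i \<in> A i)}"

definition veronese_ring :: "nat \<Rightarrow> nat \<Rightarrow> 'k::comm_ring_1 mpoly ring" where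
  "veronese_ring n d =
     ring_of_type_algebra\<lparr>carrier :=
       internal_sum {0..} (\<lambda>i. homogeneous_component n (i * int d))\<rparr>"

text \<open>The fields \<open>mult\<close> and \<open>one\<close> of a module record play no role.\<close>

definition veronese_canonical_module ::
  "nat \<Rightarrow> nat \<Rightarrow> ('k::comm_ring_1 mpoly, 'k mpoly) module" where
  "veronese_canonical_module n d =
     \<lparr>carrier = internal_sum UNIV (\<lambda>i. homogeneous_component n (i * int d - int n)),
      monoid.mult = (*), one = 1, ring.zero = 0, add = (+), module.smult = (*)\<rparr>"


section \<open>The definitions yield a commutative ring and modules over it\<close>


lemma monomial_degree_add: "monomial_degree (a + b) = monomial_degree a + monomial_degree b"
proof -
  have gen: "monomial_degree m = (\<Sum>i\<in>A. Poly_Mapping.lookup m i)"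
    if "finite A" "Poly_Mapping.keys m \<subseteq> A" for m A
    unfolding monomial_degree_def using that
    by (intro sum.mono_neutral_left) (auto simp: in_keys_iff)
  let ?A = "Poly_Mapping.keys a \<union> Poly_Mapping.keys b"
  have "Poly_Mapping.keys (a + b) \<subseteq> ?A" by (rule Poly_Mapping.keys_add)
  then show ?thesis
    using gen[of ?A "a + b"] gen[of ?A a] gen[of ?A b]
    by (simp add: lookup_add sum.distrib)
qed

lemma internal_sum_homogeneous:
  "internal_sum I (\<lambda>i. homogeneous_component n (c i)) =
     {f \<in> polynomials n. \<forall>m \<in> Poly_Mapping.keys f. \<exists>i\<in>I. int (monomial_degree m) = c i}"
  (is "?L = ?R")
proof (intro equalityI subsetI)
  fix f assume "f \<in> ?L"
  then obtain J g where f: "f = (\<Sum>i\<in>J. g i)" and J: "finite J" "J \<subseteq> I"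
    and g: "\<forall>i\<in>J. g i \<in> homogeneous_component n (c i)"
    by (auto simp: internal_sum_def)
  have "Poly_Mapping.keys f \<subseteq> (\<Union>i\<in>J. Poly_Mapping.keys (g i))"
    unfolding f by (rule Poly_Mapping.keys_sum)
  with g J(2) show "f \<in> ?R" unfolding homogeneous_component_def polynomials_def by blast
next
  fix f :: "'a mpoly" assume f: "f \<in> ?R"
  then have "\<forall>m\<in>Poly_Mapping.keys f. \<exists>i. i \<in> I \<and> int (monomial_degree m) = c i" by blast
  from bchoice[OF this] obtain s where
    s: "\<And>m. m \<in> Poly_Mapping.keys f \<Longrightarrow> s m \<in> I \<and> int (monomial_degree m) = c (s m)" by blast
  define K where "K = Poly_Mapping.keys f"
  have finK: "finite K" by (simp add: K_def)
  define g where "g i = (\<Sum>m\<in>{m\<in>K. s m = i}. Poly_Mapping.single m (Poly_Mapping.lookup f m))" for i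
  have "f = (\<Sum>m\<in>K. Poly_Mapping.single m (Poly_Mapping.lookup f m))"
    proof (rule poly_mapping_eqI)
    fix k
    show "Poly_Mapping.lookup f k =
      Poly_Mapping.lookup (\<Sum>m\<in>K. Poly_Mapping.single m (Poly_Mapping.lookup f m)) k"
      by (simp add: lookup_sum lookup_single when_def finK) (simp add: K_def in_keys_iff)
  qed
  also have "\<dots> = (\<Sum>i\<in>s ` K. g i)"
    unfolding g_def using finK by (rule sum.image_gen)
  finally have 1: "f = (\<Sum>i\<in>s ` K. g i)" .
  have "g i \<in> homogeneous_component n (c i)" if "i \<in> s ` K" for i
  proof -
    have "Poly_Mapping.keys (g i) \<subseteq> (\<Union>m\<in>{m\<in>K. s m = i}. Poly_Mapping.keys (Poly_Mapping.single m (Poly_Mapping.lookup f m)))"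
      unfolding g_def by (rule Poly_Mapping.keys_sum)
    also have "\<dots> \<subseteq> {m\<in>K. s m = i}" by (auto split: if_splits)
    finally show ?thesis
      using f s unfolding homogeneous_component_def polynomials_def K_def by blast
  qed
  with 1 finK s show "f \<in> ?L"
    unfolding internal_sum_def K_def by blast
qed

lemma mpoly_keys_multE:
  fixes f g :: "'k::comm_ring_1 mpoly"
  assumes "m \<in> Poly_Mapping.keys (f * g)"
  obtains a b where "a \<in> Poly_Mapping.keys f" "b \<in> Poly_Mapping.keys g" "m = a + b"
  using keys_mult[of f g] assms by blast

lemma polynomials_closed:
  fixes f g :: "'k::comm_ring_1 mpoly"
  assumes "f \<in> polynomials n" "g \<in> polynomials n"
  shows "f + g \<in> polynomials n" "f * g \<in> polynomials n" "- f \<in> polynomials n"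
    "0 \<in> polynomials n" "1 \<in> polynomials n"
proof -
  show "f + g \<in> polynomials n" using assms Poly_Mapping.keys_add[of f g] unfolding polynomials_def by blast
  show "f * g \<in> polynomials n" unfolding polynomials_def
  proof (intro CollectI ballI)
    fix m assume "m \<in> Poly_Mapping.keys (f * g)"
    then obtain a b where ab: "a \<in> Poly_Mapping.keys f" "b \<in> Poly_Mapping.keys g" "m = a + b"
      by (rule mpoly_keys_multE)
    have "Poly_Mapping.keys a \<subseteq> {..<n}" "Poly_Mapping.keys b \<subseteq> {..<n}"
      using ab assms unfolding polynomials_def by auto
    then show "Poly_Mapping.keys m \<subseteq> {..<n}"
      using Poly_Mapping.keys_add[of a b] ab(3) by (meson Un_least order_trans)
  qed
qed (use assms in \<open>auto simp: polynomials_def\<close>)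

lemma veronese_carrier:
  "carrier (veronese_ring n d :: 'k::comm_ring_1 mpoly ring) =
    {f \<in> polynomials n. \<forall>m \<in> Poly_Mapping.keys f. d dvd monomial_degree m}"
proof -
  have "(\<exists>i\<in>{0..}. int k = i * int d) \<longleftrightarrow> d dvd k" for k
  proof
    assume "\<exists>i\<in>{0..}. int k = i * int d"
    then obtain i where "int k = i * int d" by blast
    then have "int d dvd int k" by (simp only: dvd_triv_right)
    then show "d dvd k" by simp
  next
    assume "d dvd k"
    then obtain q where "k = d * q" ..
    then show "\<exists>i\<in>{0..}. int k = i * int d" by (intro bexI[of _ "int q"]) auto
  qed
  then show ?thesis by (simp add: veronese_ring_def internal_sum_homogeneous)
qed

lemma canonical_carrier:
  "carrier (veronese_canonical_module n d :: ('k::comm_ring_1 mpoly, 'k mpoly) module) =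
    {f \<in> polynomials n. \<forall>m \<in> Poly_Mapping.keys f. d dvd monomial_degree m + n}"
proof -
  have "(\<exists>i. int k = i * int d - int n) \<longleftrightarrow> d dvd k + n" for k
  proof -
    have "(\<exists>i. int k = i * int d - int n) \<longleftrightarrow> int d dvd int (k + n)"
      unfolding dvd_def by (metis add_diff_cancel_right' diff_add_cancel mult.commute of_nat_add)
    then show ?thesis by presburger
  qed
  then show ?thesis by (simp add: veronese_canonical_module_def internal_sum_homogeneous)
qed

lemma ring_of_type_algebra_sel [simp]: "add ring_of_type_algebra = (+)" "monoid.mult ring_of_type_algebra = (*)"
  "one ring_of_type_algebra = 1" "ring.zero ring_of_type_algebra = 0" "carrier ring_of_type_algebra = UNIV"
  by (simp_all add: ring_of_type_algebra_def)

lemma veronese_cring: "cring (veronese_ring n d :: 'k::comm_ring_1 mpoly ring)"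
proof -
  let ?V = "veronese_ring n d :: 'k mpoly ring"
  have sel: "add ?V = (+)" "monoid.mult ?V = (*)" "one ?V = 1" "ring.zero ?V = 0"
    by (simp_all add: veronese_ring_def)
  have plus: "f + g \<in> carrier ?V" if "f \<in> carrier ?V" "g \<in> carrier ?V" for f g
    using that Poly_Mapping.keys_add[of f g] unfolding veronese_carrier by (auto intro: polynomials_closed)
  have times: "f * g \<in> carrier ?V" if "f \<in> carrier ?V" "g \<in> carrier ?V" for f g
    using that unfolding veronese_carrier by (auto intro: polynomials_closed elim!: mpoly_keys_multE simp: monomial_degree_add)
  have zo: "0 \<in> carrier ?V" "1 \<in> carrier ?V"
    unfolding veronese_carrier by (auto simp: polynomials_def monomial_degree_def)
  have neg: "- f \<in> carrier ?V" if "f \<in> carrier ?V" for f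
    using that unfolding veronese_carrier by (auto intro: polynomials_closed)
  show ?thesis
  proof (rule cringI)
    show "abelian_group ?V"
      by (rule abelian_groupI) (auto simp: sel plus zo add_ac intro!: bexI[OF _ neg])
    show "comm_monoid ?V"
      by (rule comm_monoidI) (auto simp: sel times zo mult_ac)
  qed (simp add: sel algebra_simps)
qed

lemma canonical_module:
  "module (veronese_ring n d :: 'k::comm_ring_1 mpoly ring) (veronese_canonical_module n d)"
proof -
  let ?V = "veronese_ring n d :: 'k mpoly ring"
  let ?M = "veronese_canonical_module n d :: ('k mpoly, 'k mpoly) module"
  have sel: "add ?V = (+)" "monoid.mult ?V = (*)" "one ?V = 1" "ring.zero ?V = 0"
     "add ?M = (+)" "module.smult ?M = (*)" "ring.zero ?M = 0"
    by (simp_all add: veronese_ring_def veronese_canonical_module_def)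
  have plus: "f + g \<in> carrier ?M" if "f \<in> carrier ?M" "g \<in> carrier ?M" for f g
    using that Poly_Mapping.keys_add[of f g] unfolding canonical_carrier by (auto intro: polynomials_closed)
  have times: "f * g \<in> carrier ?M" if "f \<in> carrier ?V" "g \<in> carrier ?M" for f g
    using that unfolding canonical_carrier veronese_carrier
    by (auto intro: polynomials_closed elim!: mpoly_keys_multE simp: monomial_degree_add add.assoc)
  have zo: "0 \<in> carrier ?M"
    unfolding canonical_carrier by (auto simp: polynomials_def)
  have neg: "- f \<in> carrier ?M" if "f \<in> carrier ?M" for f
    using that unfolding canonical_carrier by (auto intro: polynomials_closed)
  show ?thesis
  proof (rule moduleI)
    show "abelian_group ?M"
      by (rule abelian_groupI) (auto simp: sel plus zo add_ac intro!: bexI[OF _ neg])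
  qed (simp_all add: veronese_cring sel times algebra_simps)
qed

lemma direct_power_module:
  assumes "module R M" shows "module R (direct_power N M)"
proof -
  interpret module R M by fact
  show ?thesis
  proof (rule moduleI)
    show "abelian_group (direct_power N M)"
    proof (rule abelian_groupI)
      fix x assume x: "x \<in> carrier (direct_power N M)"
      show "\<exists>y\<in>carrier (direct_power N M). y \<oplus>\<^bsub>direct_power N M\<^esub> x = \<zero>\<^bsub>direct_power N M\<^esub>"
        by (rule bexI[of _ "\<lambda>i\<in>{..<N}. \<ominus>\<^bsub>M\<^esub> x i"])
          (use x in \<open>auto simp: direct_power_def PiE_iff M.l_neg intro!: restrict_ext\<close>)
    qed (auto simp: direct_power_def PiE_iff M.a_ac extensional_def restrict_def fun_eq_iff)
  qed (auto simp: direct_power_def PiE_iff smult_l_distr smult_r_distr smult_assoc1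
        extensional_def restrict_def fun_eq_iff is_cring)
qed

end

theory Submission
  imports Defs
begin

text \<open>
  Write \<open>R\<close> for the Veronese ring, \<open>q = p\<^sup>e\<close>, and \<open>M\<^sub>j\<close> for the part of \<open>S\<close> spanned by the monomials whose degree is
  congruent to \<open>j\<close> modulo \<open>d\<close>.  Let \<open>c < d\<close> be the residue with \<open>d dvd c + n\<close>.  The canonical module is \<open>M\<^sub>c\<close>,
  and \<open>c\<close> is its lowest degree.  Let \<open>D\<^sub>j\<close> be the number of monomials of degree \<open>j\<close> in \<open>n\<close> variables.

  \<^bold>\<open>Decomposition.\<close>  As \<open>K\<close> is perfect, each element of the canonical module is, in exactly one way, a sum of terms
  \<open>x\<^sup>a h\<^sup>q\<close>, one for each pair \<open>(a, j)\<close> consisting of an exponent \<open>a\<close> with all entries below \<open>q\<close> and a residue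
  \<open>j < d\<close> such that \<open>d dvd \<bar>a\<bar> + q j + n\<close>, where \<open>h\<close> is in \<open>M\<^sub>j\<close>.  Such a pair is called a slot, and the
  pushforward of the canonical module is the direct sum of one copy of \<open>M\<^sub>j\<close> per slot \<open>(a, j)\<close>
  (\<open>slot_decomposition\<close>, \<open>slot_part_of_slot\<close>).  There are exactly \<open>q\<^sup>n\<close> slots, and every \<open>M\<^sub>j\<close> has rank one,
  so the rank is \<open>q\<^sup>n\<close> (\<open>module_rank_F\<omega>\<close>).  For fixed \<open>j\<close> the number \<open>m\<^sub>j\<close> of slots \<open>(a, j)\<close> is
  \<open>q\<^sup>n / d\<close> up to an error of at most \<open>q\<close> to the power \<open>n - 1\<close>.  Slots are pairs, and not only exponents
  \<open>a\<close>, because \<open>p\<close> may divide \<open>d\<close>; then some \<open>a\<close> admit several residues \<open>j\<close> and others admit none.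

  \<^bold>\<open>Upper bound.\<close>  A surjection onto \<open>N\<close> copies of \<open>M\<^sub>c\<close> is onto in degree \<open>c\<close>, where the target has dimension
  \<open>N D\<^sub>c\<close>.  An \<open>R\<close>-linear map from \<open>M\<^sub>j\<close> to \<open>M\<^sub>c\<close> is multiplication by an element of \<open>S\<close> with degrees congruent to
  \<open>c - j\<close>.  If \<open>j > c\<close> it misses degree \<open>c\<close>, and if \<open>j \<le> c\<close> only the \<open>D\<^sub>j\<close> monomials of degree \<open>j\<close>
  reach degree \<open>c\<close>.  Hence \<open>N D\<^sub>c\<close> is at most the sum of the \<open>m\<^sub>j D\<^sub>j\<close> over \<open>j \<le> c\<close>
  (\<open>low_degree_vanishing\<close>, \<open>surjection_upper_bound\<close>).

  \<^bold>\<open>Lower bound.\<close>  The Toeplitz matrix with entries \<open>x\<^sub>k\<^sub>-\<^sub>l\<close> gives a surjection from \<open>n + j\<close> copies of \<open>M\<^sub>j\<close> onto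
  \<open>j + 1\<close> copies of the next module, as long as \<open>j + 1 < d\<close>, over any field (\<open>surjective_matrix_toeplitz\<close>).
  Because \<open>(n + j) D\<^sub>j\<close> equals \<open>(j + 1)\<close> times the next \<open>D\<close>, this map is bijective in the lowest degree: no dimension
  is wasted.  Tensor products of these matrices give surjections of \<open>r\<close> copies of \<open>M\<^sub>j\<close> onto \<open>s\<close> copies of \<open>M\<^sub>c\<close> with
  \<open>r D\<^sub>j = s D\<^sub>c\<close>.  Cutting the \<open>m\<^sub>j\<close> copies of \<open>M\<^sub>j\<close> into blocks of \<open>r\<close>, for each \<open>j \<le> c\<close>, shows that the
  upper bound is attained up to an error of smaller order (\<open>surjection_exists\<close>).

  Both bounds, divided by \<open>q\<^sup>n\<close>, tend to the sum of the \<open>D\<^sub>j / (d D\<^sub>c)\<close> over \<open>j \<le> c\<close>, which is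
  \<open>(n + c) / (n d)\<close> (\<open>sum_card_exponents_of_degree\<close>), and \<open>(n + c) / d\<close> is the ceiling of \<open>n / d\<close>.
\<close>

section \<open>Exponents and monomials\<close>

abbreviation xpow :: "(nat \<Rightarrow>\<^sub>0 nat) \<Rightarrow> 'k::comm_ring_1 mpoly" where
  "xpow m \<equiv> Poly_Mapping.single m 1"

definition exponents :: "nat \<Rightarrow> (nat \<Rightarrow>\<^sub>0 nat) set" where
  "exponents n = {m. Poly_Mapping.keys m \<subseteq> {..<n}}"

definition exponents_of_degree :: "nat \<Rightarrow> nat \<Rightarrow> (nat \<Rightarrow>\<^sub>0 nat) set" where
  "exponents_of_degree n j = {m \<in> exponents n. monomial_degree m = j}"

definition exponent_box :: "nat \<Rightarrow> nat \<Rightarrow> (nat \<Rightarrow>\<^sub>0 nat) set" where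
  "exponent_box n q = {m \<in> exponents n. \<forall>i. Poly_Mapping.lookup m i < q}"

definition scale_exponent :: "nat \<Rightarrow> (nat \<Rightarrow>\<^sub>0 nat) \<Rightarrow> (nat \<Rightarrow>\<^sub>0 nat)" where
  "scale_exponent q m = Poly_Mapping.map ((*) q) m"

lemma lookup_scale_exponent [simp]:
  "Poly_Mapping.lookup (scale_exponent q m) i = q * Poly_Mapping.lookup m i"
  by (simp add: scale_exponent_def map.rep_eq when_def)

lemma monomial_degree_eq_sum:
  assumes "m \<in> exponents n"
  shows "monomial_degree m = (\<Sum>i<n. Poly_Mapping.lookup m i)"
  unfolding monomial_degree_def using assms
  by (intro sum.mono_neutral_left) (auto simp: exponents_def in_keys_iff)

lemma monomial_degree_simps [simp]:
  "monomial_degree 0 = 0" "monomial_degree (Poly_Mapping.single i k) = k"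
  by (simp_all add: monomial_degree_def)

lemma lookup_le_monomial_degree: "Poly_Mapping.lookup m i \<le> monomial_degree m"
proof (cases "i \<in> Poly_Mapping.keys m")
  case True
  then show ?thesis unfolding monomial_degree_def by (intro member_le_sum) auto
qed (simp add: in_keys_iff)

lemma monomial_degree_scale [simp]: "monomial_degree (scale_exponent q m) = q * monomial_degree m"
proof (cases "q = 0")
  case False
  then have "Poly_Mapping.keys (scale_exponent q m) = Poly_Mapping.keys m"
    by (auto simp: in_keys_iff)
  then show ?thesis by (simp add: monomial_degree_def sum_distrib_left)
next
  case True
  then have "scale_exponent q m = 0" by (intro poly_mapping_eqI) simp
  then show ?thesis using True by simp
qed

lemma exponents_add_iff [simp]: "a + b \<in> exponents n \<longleftrightarrow> a \<in> exponents n \<and> b \<in> exponents n"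
  by (auto simp: exponents_def in_keys_iff lookup_add subset_iff)

lemma scale_in_exponents: "m \<in> exponents n \<Longrightarrow> scale_exponent q m \<in> exponents n"
  by (auto simp: exponents_def in_keys_iff subset_iff)

lemma scale_in_exponents_iff: "q > 0 \<Longrightarrow> scale_exponent q m \<in> exponents n \<longleftrightarrow> m \<in> exponents n"
  by (auto simp: exponents_def in_keys_iff subset_iff)

lemma zero_in_exponents [simp]: "0 \<in> exponents n"
  by (simp add: exponents_def)

lemma single_in_exponents: "i < n \<Longrightarrow> Poly_Mapping.single i k \<in> exponents n"
  by (simp add: exponents_def)

lemma scale_exponent_add: "scale_exponent q (a + b) = scale_exponent q a + scale_exponent q b"
  by (rule poly_mapping_eqI) (simp add: lookup_add algebra_simps)

text \<open>
  Together with uniqueness below: the monomials \<open>x\<^sup>a\<close> with \<open>a\<close> in the box form a basis of \<open>S\<close> over the subring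
  of \<open>q\<close>-th powers when \<open>K\<close> is perfect.
\<close>

lemma exponent_division:
  assumes "b \<in> exponents n" "q > 0"
  obtains a m where "a \<in> exponent_box n q" "m \<in> exponents n" "b = scale_exponent q m + a"
proof
  let ?a = "Poly_Mapping.map (\<lambda>x. x mod q) b" and ?m = "Poly_Mapping.map (\<lambda>x. x div q) b"
  have la: "Poly_Mapping.lookup ?a i = Poly_Mapping.lookup b i mod q" for i
    by (simp add: map.rep_eq when_def)
  have lm: "Poly_Mapping.lookup ?m i = Poly_Mapping.lookup b i div q" for i
    by (simp add: map.rep_eq when_def)
  have "Poly_Mapping.keys ?a \<subseteq> Poly_Mapping.keys b" "Poly_Mapping.keys ?m \<subseteq> Poly_Mapping.keys b"
    by (rule subsetI, metis in_keys_iff la mod_0) (rule subsetI, metis in_keys_iff lm div_0)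
  then show "?a \<in> exponent_box n q" "?m \<in> exponents n"
    using assms by (auto simp: exponent_box_def exponents_def la)
  show "b = scale_exponent q ?m + ?a"
    by (rule poly_mapping_eqI) (simp add: lookup_add la lm)
qed

lemma exponent_division_unique:
  assumes "a \<in> exponent_box n q" "a' \<in> exponent_box n q"
    and eq: "scale_exponent q m + a = scale_exponent q m' + a'"
  shows "m = m' \<and> a = a'"
proof -
  have *: "q * Poly_Mapping.lookup m i + Poly_Mapping.lookup a i
      = q * Poly_Mapping.lookup m' i + Poly_Mapping.lookup a' i" for i
    using arg_cong[OF eq, of "\<lambda>m. Poly_Mapping.lookup m i"] by (simp add: lookup_add)
  have lt: "Poly_Mapping.lookup a i < q" "Poly_Mapping.lookup a' i < q" for i
    using assms by (auto simp: exponent_box_def)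
  have "Poly_Mapping.lookup m i = Poly_Mapping.lookup m' i \<and> Poly_Mapping.lookup a i = Poly_Mapping.lookup a' i" for i
  proof -
    have "(q * Poly_Mapping.lookup m i + Poly_Mapping.lookup a i) div q = Poly_Mapping.lookup m i"
      "(q * Poly_Mapping.lookup m' i + Poly_Mapping.lookup a' i) div q = Poly_Mapping.lookup m' i"
      using lt[of i] by simp_all
    then have "Poly_Mapping.lookup m i = Poly_Mapping.lookup m' i" using * by simp
    with *[of i] show ?thesis by simp
  qed
  then show ?thesis by (auto intro: poly_mapping_eqI)
qed

lemma exponent_split:
  assumes "m \<in> exponents n" "k \<le> monomial_degree m"
  obtains m1 m2 where "m = m1 + m2" "m1 \<in> exponents_of_degree n k" "m2 \<in> exponents n"
proof -
  have "\<exists>m1 m2. m = m1 + m2 \<and> monomial_degree m1 = k" using assms(2)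
  proof (induction k)
    case 0
    show ?case by (intro exI[of _ 0] exI[of _ m]) simp
  next
    case (Suc k)
    then obtain m1 m2 where m: "m = m1 + m2" "monomial_degree m1 = k" by auto
    then have "m2 \<noteq> 0" using Suc.prems by (auto simp: monomial_degree_add)
    then obtain i where i: "Poly_Mapping.lookup m2 i \<noteq> 0"
      by (metis lookup_zero poly_mapping_eqI)
    let ?u = "Poly_Mapping.single i (1::nat)"
    have "m2 = ?u + (m2 - ?u)"
      using i by (intro poly_mapping_eqI) (auto simp: lookup_add lookup_minus lookup_single when_def)
    then show ?case
      by (intro exI[of _ "m1 + ?u"] exI[of _ "m2 - ?u"]) (simp add: m monomial_degree_add add.assoc)
  qed
  then show ?thesis using assms(1) that by (auto simp: exponents_of_degree_def)
qed

lemma mpoly_expansion: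
  "(f :: 'k::comm_ring_1 mpoly) = (\<Sum>m\<in>Poly_Mapping.keys f. Poly_Mapping.single m (Poly_Mapping.lookup f m))"
  by (rule poly_mapping_eqI) (simp add: lookup_sum lookup_single when_def in_keys_iff)

lemma single_eq_const_mult: "Poly_Mapping.single m c = Poly_Mapping.single 0 c * (xpow m :: 'k::comm_ring_1 mpoly)"
  by (simp add: mult_single)

lemma single_mult_expansion:
  "Poly_Mapping.single m c * (f :: 'k::comm_ring_1 mpoly)
    = (\<Sum>k\<in>Poly_Mapping.keys f. Poly_Mapping.single (m + k) (c * Poly_Mapping.lookup f k))"
  by (subst mpoly_expansion[of f]) (simp add: sum_distrib_left mult_single)

lemma lookup_xpow_mult_shift [simp]:
  "Poly_Mapping.lookup (xpow m * (f :: 'k::comm_ring_1 mpoly)) (m + k) = Poly_Mapping.lookup f k"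
  by (simp add: single_mult_expansion lookup_sum lookup_single when_def in_keys_iff)

lemma lookup_const_mult [simp]:
  "Poly_Mapping.lookup (Poly_Mapping.single 0 c * (f :: 'k::comm_ring_1 mpoly)) k = c * Poly_Mapping.lookup f k"
  by (simp add: single_mult_expansion lookup_sum lookup_single when_def in_keys_iff)

lemma lookup_xpow_mult_eq_0:
  assumes "\<And>k'. k \<noteq> m + k'"
  shows "Poly_Mapping.lookup (xpow m * (f :: 'k::comm_ring_1 mpoly)) k = 0"
proof -
  have "\<forall>k'\<in>Poly_Mapping.keys f. m + k' \<noteq> k" using assms by metis
  then show ?thesis by (simp add: single_mult_expansion lookup_sum lookup_single when_def)
qed

lemma xpow_mult: "xpow a * xpow b = (xpow (a + b) :: 'k::comm_ring_1 mpoly)"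
  by (simp add: mult_single)

lemma single_power:
  "Poly_Mapping.single m c ^ q = Poly_Mapping.single (scale_exponent q m) ((c::'k::comm_ring_1) ^ q)"
proof (induction q)
  case 0
  have "scale_exponent 0 m = 0" by (intro poly_mapping_eqI) simp
  then show ?case by simp
next
  case (Suc q)
  have "scale_exponent (Suc q) m = m + scale_exponent q m" by (intro poly_mapping_eqI) (simp add: lookup_add)
  then show ?case using Suc by (simp add: mult_single)
qed

lemma xpow_nonzero [simp]: "xpow m \<noteq> (0 :: 'k::field mpoly)"
  by (metis lookup_single_eq lookup_zero zero_neq_one)

text \<open>
  The module \<open>M\<^sub>j\<close> of the introduction.  Only \<open>j mod d\<close> matters, so that products may be formed by adding indices.
\<close>

definition residue_part :: "nat \<Rightarrow> nat \<Rightarrow> nat \<Rightarrow> 'k::comm_ring_1 mpoly set" where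
  "residue_part n d j = {f \<in> polynomials n. \<forall>m \<in> Poly_Mapping.keys f. monomial_degree m mod d = j mod d}"

lemma polynomials_iff_exponents: "f \<in> polynomials n \<longleftrightarrow> Poly_Mapping.keys f \<subseteq> exponents n"
  by (auto simp: polynomials_def exponents_def)

lemma residue_part_0: "0 \<in> residue_part n d j"
  by (simp add: residue_part_def polynomials_def)

lemma residue_part_add: "f \<in> residue_part n d j \<Longrightarrow> g \<in> residue_part n d j \<Longrightarrow> f + g \<in> residue_part n d j"
  using Poly_Mapping.keys_add[of f g] by (auto simp: residue_part_def intro: polynomials_closed)

lemma residue_part_sum: "(\<And>x. x \<in> A \<Longrightarrow> f x \<in> residue_part n d j) \<Longrightarrow> sum f A \<in> residue_part n d j"
  by (induction A rule: infinite_finite_induct) (auto intro: residue_part_0 residue_part_add)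

lemma residue_part_uminus: "f \<in> residue_part n d j \<Longrightarrow> - f \<in> residue_part n d j"
  by (auto simp: residue_part_def intro: polynomials_closed)

lemma residue_part_mult:
  assumes "f \<in> residue_part n d i" "g \<in> residue_part n d j"
  shows "f * g \<in> residue_part n d (i + j)"
  using assms unfolding residue_part_def
  by (auto intro: polynomials_closed elim!: mpoly_keys_multE simp: monomial_degree_add)
    (metis mod_add_eq)

lemma residue_part_cong: "i mod d = j mod d \<Longrightarrow> residue_part n d i = residue_part n d j"
  by (simp add: residue_part_def)

lemma single_in_residue_part:
  "m \<in> exponents n \<Longrightarrow> monomial_degree m mod d = j mod d \<Longrightarrow> Poly_Mapping.single m c \<in> residue_part n d j"
  by (auto simp: residue_part_def polynomials_iff_exponents)

lemma residue_part_keysD: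
  "f \<in> residue_part n d j \<Longrightarrow> m \<in> Poly_Mapping.keys f \<Longrightarrow> m \<in> exponents n \<and> monomial_degree m mod d = j mod d"
  by (auto simp: residue_part_def polynomials_iff_exponents)

lemma one_in_residue_part: "1 \<in> residue_part n d 0"
  by (metis single_in_residue_part monomial_degree_simps(1) single_one zero_in_exponents)

lemma residue_part_power_eq: "f \<in> residue_part n d j \<Longrightarrow> f ^ k \<in> residue_part n d (k * j)"
  by (induction k) (auto simp: one_in_residue_part intro: residue_part_mult)

section \<open>Counting exponents\<close>

lemma residue_class_representative:
  assumes "d > (0::nat)"
  obtains r where "r < d" "\<And>k. d dvd k + s \<longleftrightarrow> k mod d = r"
proof
  let ?r = "(d - s mod d) mod d"
  show "?r < d" using assms by simp
  have 0: "d dvd ?r + s"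
  proof -
    have "(?r + s) mod d = (d - s mod d + s mod d) mod d" by presburger
    also have "\<dots> = 0" using assms by (simp add: less_imp_le)
    finally show ?thesis by auto
  qed
  show "d dvd k + s \<longleftrightarrow> k mod d = ?r" for k
  proof -
    have "d dvd k + s \<longleftrightarrow> int d dvd (int k - int ?r) + int (?r + s)"
      by (simp add: algebra_simps flip: int_dvd_int_iff)
    also have "\<dots> \<longleftrightarrow> int d dvd int k - int ?r"
      using 0 by (intro dvd_add_left_iff) (simp only: int_dvd_int_iff)
    also have "\<dots> \<longleftrightarrow> int k mod int d = int ?r mod int d"
      by (simp only: mod_eq_dvd_iff)
    also have "\<dots> \<longleftrightarrow> k mod d = ?r"
      by (simp flip: of_nat_mod)
    finally show ?thesis .
  qed
qed

lemma card_residue_class_multiple: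
  assumes "d > (0::nat)"
  shows "card {k. k < q * d \<and> d dvd k + s} = q"
proof -
  obtain r where r: "r < d" "\<And>k. d dvd k + s \<longleftrightarrow> k mod d = r"
    using residue_class_representative[OF assms] by metis
  have "{k. k < q * d \<and> k mod d = r} = (\<lambda>i. i * d + r) ` {..<q}"
  proof (intro equalityI subsetI)
    fix k assume "k \<in> {k. k < q * d \<and> k mod d = r}"
    then show "k \<in> (\<lambda>i. i * d + r) ` {..<q}"
      using assms by (intro image_eqI[of _ _ "k div d"]) (auto simp: less_mult_imp_div_less)
  next
    fix k assume "k \<in> (\<lambda>i. i * d + r) ` {..<q}"
    then obtain i where i: "k = i * d + r" "i < q" by auto
    have "i * d + r < Suc i * d" using r by simp
    also have "\<dots> \<le> q * d" using i by (intro mult_right_mono) auto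
    finally show "k \<in> {k. k < q * d \<and> k mod d = r}" using i r by auto
  qed
  moreover have "inj_on (\<lambda>i. i * d + r) {..<q}" using assms by (auto simp: inj_on_def)
  ultimately show ?thesis by (simp add: r card_image)
qed

lemma card_residue_class_bounds:
  assumes "d > (0::nat)"
  shows "real T / real d - 1 \<le> real (card {k. k < T \<and> d dvd k + s})"
    and "real (card {k. k < T \<and> d dvd k + s}) \<le> real T / real d + 1"
proof -
  let ?u = "T div d"
  have fin: "finite {k. k < T' \<and> d dvd k + s}" for T' by simp
  have le: "?u * d \<le> T" "T \<le> (?u + 1) * d"
    using assms dividend_less_times_div[of d T] by (auto simp: algebra_simps)
  have "card {k. k < ?u * d \<and> d dvd k + s} \<le> card {k. k < T \<and> d dvd k + s}"
    by (rule card_mono[OF fin]) (use order_less_le_trans[OF _ le(1)] in blast)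
  moreover have "card {k. k < T \<and> d dvd k + s} \<le> card {k. k < (?u + 1) * d \<and> d dvd k + s}"
    by (rule card_mono[OF fin]) (use order_less_le_trans[OF _ le(2)] in blast)
  ultimately have b: "?u \<le> card {k. k < T \<and> d dvd k + s}" "card {k. k < T \<and> d dvd k + s} \<le> ?u + 1"
    using card_residue_class_multiple[OF assms] by metis+
  have "real T / real d \<le> real ?u + 1"
  proof -
    have "real T \<le> (real ?u + 1) * real d"
      using le(2) by (metis of_nat_1 of_nat_add of_nat_le_iff of_nat_mult)
    then show ?thesis using assms by (simp add: divide_le_eq)
  qed
  moreover have "real ?u \<le> real T / real d" by (simp add: of_nat_div_le_of_nat)
  ultimately show "real T / real d - 1 \<le> real (card {k. k < T \<and> d dvd k + s})"
    "real (card {k. k < T \<and> d dvd k + s}) \<le> real T / real d + 1" using b by linarith+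
qed

text \<open>
  Congruence conditions on the degree of an exponent in the box are counted one line at a time: once the entries other
  than the one at index \<open>0\<close> are fixed, the condition singles out a residue class for that entry.
\<close>

definition box_tail :: "nat \<Rightarrow> nat \<Rightarrow> (nat \<Rightarrow>\<^sub>0 nat) set" where
  "box_tail n q = {a \<in> exponent_box n q. Poly_Mapping.lookup a 0 = 0}"

lemma card_box_tail:
  assumes "q > 0" "n > 0"
  shows "finite (box_tail n q)" "card (box_tail n q) = q ^ (n - 1)"
proof -
  let ?P = "{1..<n} \<rightarrow>\<^sub>E {..<q}"
  let ?F = "\<lambda>a::nat \<Rightarrow>\<^sub>0 nat. restrict (Poly_Mapping.lookup a) {1..<n}"
  have out: "Poly_Mapping.lookup a i = 0" if "a \<in> box_tail n q" "i \<notin> {1..<n}" for a i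
    using that by (cases "i = 0") (auto simp: box_tail_def exponent_box_def exponents_def in_keys_iff subset_iff)
  have "bij_betw ?F (box_tail n q) ?P"
  proof (rule bij_betw_imageI)
    show "inj_on ?F (box_tail n q)"
    proof (rule inj_onI)
      fix a b assume ab: "a \<in> box_tail n q" "b \<in> box_tail n q" "?F a = ?F b"
      show "a = b"
      proof (rule poly_mapping_eqI)
        fix i show "Poly_Mapping.lookup a i = Poly_Mapping.lookup b i"
          using out[OF ab(1)] out[OF ab(2)] fun_cong[OF ab(3), of i] by (cases "i \<in> {1..<n}") auto
      qed
    qed
    show "?F ` box_tail n q = ?P"
    proof (intro equalityI subsetI)
      fix f assume f: "f \<in> ?P"
      define a where "a = (\<Sum>i\<in>{1..<n}. Poly_Mapping.single i (f i))"
      have la: "Poly_Mapping.lookup a i = (if i \<in> {1..<n} then f i else 0)" for i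
        by (simp add: a_def lookup_sum lookup_single when_def)
      show "f \<in> ?F ` box_tail n q"
      proof (rule image_eqI)
        show "f = ?F a"
          using f by (auto simp: la fun_eq_iff restrict_def PiE_iff extensional_def)
        show "a \<in> box_tail n q"
          using f assms by (auto simp: box_tail_def exponent_box_def exponents_def in_keys_iff la PiE_iff split: if_splits)
      qed
    qed (auto simp: box_tail_def exponent_box_def)
  qed
  note bij = this
  have "finite ?P" by (intro finite_PiE) auto
  with bij show "finite (box_tail n q)" by (simp add: bij_betw_finite)
  show "card (box_tail n q) = q ^ (n - 1)"
    using bij_betw_same_card[OF bij] by (simp add: card_PiE)
qed

lemma exponent_box_split:
  assumes "q > 0" "n > 0"
  shows "bij_betw (\<lambda>(t, k). t + Poly_Mapping.single 0 k) (box_tail n q \<times> {..<q}) (exponent_box n q)"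
proof (rule bij_betw_imageI)
  show "inj_on (\<lambda>(t, k). t + Poly_Mapping.single 0 k) (box_tail n q \<times> {..<q})"
  proof (rule inj_onI, clarify)
    fix t k t' k'
    assume t: "t \<in> box_tail n q" "t' \<in> box_tail n q"
      and eq: "t + Poly_Mapping.single 0 k = t' + Poly_Mapping.single (0::nat) (k'::nat)"
    have "k = k'" using t arg_cong[OF eq, of "\<lambda>a. Poly_Mapping.lookup a 0"]
      by (simp add: lookup_add box_tail_def)
    with eq show "t = t' \<and> k = k'" by simp
  qed
  show "(\<lambda>(t, k). t + Poly_Mapping.single 0 k) ` (box_tail n q \<times> {..<q}) = exponent_box n q"
  proof (intro equalityI subsetI)
    fix a assume "a \<in> (\<lambda>(t, k). t + Poly_Mapping.single 0 k) ` (box_tail n q \<times> {..<q})"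
    then obtain t k where t: "t \<in> box_tail n q" "k < q" "a = t + Poly_Mapping.single 0 k" by auto
    have "Poly_Mapping.lookup a i < q" for i
      using t by (cases "i = 0") (auto simp: box_tail_def exponent_box_def lookup_add lookup_single when_def)
    then show "a \<in> exponent_box n q"
      using t assms by (auto simp: exponent_box_def box_tail_def intro: single_in_exponents)
  next
    fix a assume a: "a \<in> exponent_box n q"
    let ?k = "Poly_Mapping.lookup a 0"
    let ?t = "a - Poly_Mapping.single 0 ?k"
    have lt: "Poly_Mapping.lookup ?t i = (if i = 0 then 0 else Poly_Mapping.lookup a i)" for i
      by (auto simp: lookup_minus lookup_single when_def)
    have "a = ?t + Poly_Mapping.single 0 ?k"
      by (rule poly_mapping_eqI) (auto simp: lookup_add lt lookup_single when_def)
    moreover have "?t \<in> box_tail n q"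
      using a assms by (auto simp: box_tail_def exponent_box_def exponents_def in_keys_iff subset_iff lt split: if_splits)
    moreover have "?k < q" using a by (simp add: exponent_box_def)
    ultimately show "a \<in> (\<lambda>(t, k). t + Poly_Mapping.single 0 k) ` (box_tail n q \<times> {..<q})"
      by (intro image_eqI[of _ _ "(?t, ?k)"]) auto
  qed
qed

lemma finite_exponent_box: "finite (exponent_box n q)"
proof (cases "q > 0 \<and> n > 0")
  case True
  then show ?thesis
    using bij_betw_finite[OF exponent_box_split[of q n]] card_box_tail(1)[of q n] by simp
next
  case False
  then have "exponent_box n q \<subseteq> {0}" by (auto simp: exponent_box_def exponents_def)
  then show ?thesis by (rule finite_subset) simp
qed

lemma card_box_residue_bounds:
  fixes n q d s :: nat
  assumes "q > 0" "n > 0" "d > 0"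
  defines "N \<equiv> card {a \<in> exponent_box n q. d dvd monomial_degree a + s}"
  shows "real q ^ n / real d - real q ^ (n - 1) \<le> real N"
    and "real N \<le> real q ^ n / real d + real q ^ (n - 1)"
proof -
  let ?A = "SIGMA t:box_tail n q. {k. k < q \<and> d dvd k + (monomial_degree t + s)}"
  let ?C = "\<lambda>t. card {k. k < q \<and> d dvd k + (monomial_degree t + s)}"
  note bij = exponent_box_split[OF assms(1,2)]
  note tail = card_box_tail[OF assms(1,2)]
  have "{a \<in> exponent_box n q. d dvd monomial_degree a + s} = (\<lambda>(t, k). t + Poly_Mapping.single 0 k) ` ?A"
    unfolding bij_betw_imp_surj_on[OF bij, symmetric]
    by (force simp: monomial_degree_add algebra_simps)
  moreover have "inj_on (\<lambda>(t, k). t + Poly_Mapping.single 0 k) ?A"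
    by (rule inj_on_subset[OF bij_betw_imp_inj_on[OF bij]]) auto
  ultimately have N: "real N = (\<Sum>t\<in>box_tail n q. real (?C t))"
    using tail(1) by (simp add: N_def card_image card_SigmaI)
  have qn: "real q ^ n = real q * real (card (box_tail n q))"
    using assms(2) tail(2) by (cases n) auto
  have "(\<Sum>t\<in>box_tail n q. real q / real d - 1) \<le> real N"
    unfolding N by (intro sum_mono card_residue_class_bounds assms)
  then show "real q ^ n / real d - real q ^ (n - 1) \<le> real N"
    using tail(2) qn by (simp add: algebra_simps)
  have "real N \<le> (\<Sum>t\<in>box_tail n q. real q / real d + 1)"
    unfolding N by (intro sum_mono card_residue_class_bounds assms)
  then show "real N \<le> real q ^ n / real d + real q ^ (n - 1)"
    using tail(2) qn by (simp add: algebra_simps)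
qed

text \<open>
  The count is exact, although the one for a single \<open>j\<close> is only approximate, because the pair \<open>(a, j)\<close> merges the entry of \<open>a\<close>
  at index \<open>0\<close> and the residue \<open>j\<close> into one number below \<open>q * d\<close>, and that range consists of full periods.
\<close>

lemma card_box_residue_pairs:
  assumes "q > 0" "n > 0" "d > 0"
  shows "card {(a, j). a \<in> exponent_box n q \<and> j < d \<and> d dvd monomial_degree a + q * j + s} = q ^ n"
proof -
  let ?A = "SIGMA t:box_tail n q. {k. k < q * d \<and> d dvd k + (monomial_degree t + s)}"
  let ?B = "{(a, j). a \<in> exponent_box n q \<and> j < d \<and> d dvd monomial_degree a + q * j + s}"
  let ?F = "\<lambda>(t, k). (t + Poly_Mapping.single 0 (k mod q), k div q)"
  note bij = exponent_box_split[OF assms(1,2)]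
  note tail = card_box_tail[OF assms(1,2)]
  have deg: "monomial_degree (t + Poly_Mapping.single 0 (k mod q)) + q * (k div q) + s
      = k + (monomial_degree t + s)" for t k
    by (simp add: monomial_degree_add)
  have "bij_betw ?F ?A ?B"
  proof (rule bij_betw_imageI)
    show "inj_on ?F ?A"
    proof (rule inj_onI, clarify)
      fix t k t' k'
      assume t: "t \<in> box_tail n q" "t' \<in> box_tail n q"
        and eq: "t + Poly_Mapping.single 0 (k mod q) = t' + Poly_Mapping.single 0 (k' mod q)"
          "k div q = k' div q"
      have "k mod q < q" "k' mod q < q" using assms by simp_all
      with t eq(1) have "t = t' \<and> k mod q = k' mod q"
        using inj_onD[OF bij_betw_imp_inj_on[OF bij], of "(t, k mod q)" "(t', k' mod q)"] by simp
      with eq(2) show "t = t' \<and> k = k'" by (metis div_mult_mod_eq)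
    qed
    show "?F ` ?A = ?B"
    proof (intro equalityI subsetI)
      fix x assume "x \<in> ?F ` ?A"
      then obtain t k where x: "x = ?F (t, k)" "t \<in> box_tail n q" "k < q * d"
        "d dvd k + (monomial_degree t + s)" by auto
      have "t + Poly_Mapping.single 0 (k mod q) \<in> exponent_box n q"
        using bij_betwE[OF bij, rule_format, of "(t, k mod q)"] x assms by auto
      moreover have "k div q < d" using x by (simp add: less_mult_imp_div_less mult.commute)
      moreover have "d dvd monomial_degree (t + Poly_Mapping.single 0 (k mod q)) + q * (k div q) + s"
        unfolding deg using x(4) .
      ultimately show "x \<in> ?B" using x(1) by simp
    next
      fix x assume "x \<in> ?B"
      then obtain a j where x: "x = (a, j)" "a \<in> exponent_box n q" "j < d"
        "d dvd monomial_degree a + q * j + s" by auto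
      have "a \<in> (\<lambda>(t, k). t + Poly_Mapping.single 0 k) ` (box_tail n q \<times> {..<q})"
        using bij_betw_imp_surj_on[OF bij] x(2) by simp
      then obtain t i where t: "t \<in> box_tail n q" "i < q" "a = t + Poly_Mapping.single 0 i"
        by auto
      let ?k = "q * j + i"
      have k: "?k mod q = i" "?k div q = j" using t by auto
      have "q * j + i < q * Suc j" using t by simp
      also have "\<dots> \<le> q * d" using x by (intro mult_left_mono) auto
      finally have "?k < q * d" .
      moreover have "d dvd ?k + (monomial_degree t + s)"
        using x(4) deg[of t ?k] k t by (simp add: add_ac)
      ultimately show "x \<in> ?F ` ?A" using t x k by (intro image_eqI[of _ _ "(t, ?k)"]) auto
    qed
  qed
  then have "card ?B = card ?A" by (rule bij_betw_same_card[symmetric])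
  also have "\<dots> = (\<Sum>t\<in>box_tail n q. q)"
    using tail(1) card_residue_class_multiple[OF assms(3), of q] by (simp add: card_SigmaI)
  also have "\<dots> = q ^ n" using tail(2) assms(2) by (cases n) auto
  finally show ?thesis .
qed

lemma finite_exponents_of_degree: "finite (exponents_of_degree n j)"
  by (rule finite_subset[OF _ finite_exponent_box[of n "Suc j"]])
    (auto simp: exponents_of_degree_def exponent_box_def less_Suc_eq_le intro: order_trans[OF lookup_le_monomial_degree])

lemma exponents_of_degree_0 [simp]: "exponents_of_degree n 0 = {0}"
proof -
  have "m = 0" if "monomial_degree m = 0" for m
    using that lookup_le_monomial_degree[of m] by (intro poly_mapping_eqI) auto
  then show ?thesis by (auto simp: exponents_of_degree_def)
qed

lemma card_exponents_of_degree_pos: "n > 0 \<Longrightarrow> card (exponents_of_degree n j) > 0"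
  using finite_exponents_of_degree[of n j]
  by (auto simp: card_gt_0_iff exponents_of_degree_def intro!: exI[of _ "Poly_Mapping.single 0 j"] single_in_exponents)

text \<open>
  Double counting of the pairs consisting of a monomial of degree \<open>j + 1\<close> and one of its \<open>j + 1\<close> factors.  It expresses the
  ratio of consecutive counts without binomial coefficients, in the form in which Toeplitz matrices produce it.
\<close>

lemma card_exponents_of_degree_Suc:
  "Suc j * card (exponents_of_degree n (Suc j)) = (n + j) * card (exponents_of_degree n j)"
proof -
  have deg: "(\<Sum>i<n. Poly_Mapping.lookup m i) = k" if "m \<in> exponents_of_degree n k" for m k
    using that by (auto simp: exponents_of_degree_def monomial_degree_eq_sum)
  have "Suc j * card (exponents_of_degree n (Suc j))
      = (\<Sum>m\<in>exponents_of_degree n (Suc j). \<Sum>i<n. Poly_Mapping.lookup m i)"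
    by (simp add: deg)
  also have "\<dots> = (\<Sum>i<n. \<Sum>m\<in>exponents_of_degree n (Suc j). Poly_Mapping.lookup m i)"
    by (rule sum.swap)
  also have "\<dots> = (\<Sum>i<n. \<Sum>m\<in>exponents_of_degree n j. Suc (Poly_Mapping.lookup m i))"
  proof (rule sum.cong[OF refl])
    fix i assume i: "i \<in> {..<n}"
    let ?u = "Poly_Mapping.single i (1::nat)"
    have "(\<Sum>m\<in>exponents_of_degree n (Suc j). Poly_Mapping.lookup m i)
        = (\<Sum>m\<in>(\<lambda>m. m + ?u) ` exponents_of_degree n j. Poly_Mapping.lookup m i)"
    proof (rule sum.mono_neutral_right[OF finite_exponents_of_degree])
      show "(\<lambda>m. m + ?u) ` exponents_of_degree n j \<subseteq> exponents_of_degree n (Suc j)"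
        using i by (auto simp: exponents_of_degree_def monomial_degree_add intro: single_in_exponents)
      show "\<forall>m\<in>exponents_of_degree n (Suc j) - (\<lambda>m. m + ?u) ` exponents_of_degree n j. Poly_Mapping.lookup m i = 0"
      proof (rule ballI, rule ccontr)
        fix m assume m: "m \<in> exponents_of_degree n (Suc j) - (\<lambda>m. m + ?u) ` exponents_of_degree n j"
          "Poly_Mapping.lookup m i \<noteq> 0"
        have "m = (m - ?u) + ?u"
          using m(2) by (intro poly_mapping_eqI) (auto simp: lookup_add lookup_minus lookup_single when_def)
        then obtain w where w: "m = w + ?u" by blast
        then have "w \<in> exponents_of_degree n j"
          using m(1) by (auto simp: exponents_of_degree_def monomial_degree_add)
        then have "m \<in> (\<lambda>m. m + ?u) ` exponents_of_degree n j"
          using w by blast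
        with m(1) show False by blast
      qed
    qed
    also have "\<dots> = (\<Sum>m\<in>exponents_of_degree n j. Suc (Poly_Mapping.lookup m i))"
      by (subst sum.reindex) (auto simp: inj_on_def lookup_add)
    finally show "(\<Sum>m\<in>exponents_of_degree n (Suc j). Poly_Mapping.lookup m i)
        = (\<Sum>m\<in>exponents_of_degree n j. Suc (Poly_Mapping.lookup m i))" .
  qed
  also have "\<dots> = (\<Sum>m\<in>exponents_of_degree n j. \<Sum>i<n. Suc (Poly_Mapping.lookup m i))"
    by (rule sum.swap)
  also have "\<dots> = (\<Sum>m\<in>exponents_of_degree n j. n + j)"
  proof (rule sum.cong[OF refl])
    fix m assume "m \<in> exponents_of_degree n j"
    then show "(\<Sum>i<n. Suc (Poly_Mapping.lookup m i)) = n + j"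
      using deg[of m j] by (simp add: sum_Suc)
  qed
  finally show ?thesis by (simp add: mult.commute)
qed

lemma sum_card_exponents_of_degree:
  "n * (\<Sum>j\<le>c. card (exponents_of_degree n j)) = (n + c) * card (exponents_of_degree n c)"
proof (induction c)
  case (Suc c)
  then show ?case using card_exponents_of_degree_Suc[of c n] by (simp add: algebra_simps)
qed simp

section \<open>Surjections between sums of copies of the modules \<open>M\<^sub>j\<close>\<close>

text \<open>
  Every \<open>R\<close>-linear map that is needed between such sums is multiplication by a matrix over \<open>S\<close>.  The
  truncated subtraction \<open>j' - j\<close> is used for \<open>j \<le> j'\<close> only.
\<close>

definition surjective_matrix ::
  "nat \<Rightarrow> nat \<Rightarrow> nat \<Rightarrow> nat \<Rightarrow> 'a set \<Rightarrow> 'b set \<Rightarrow> ('a \<Rightarrow> 'b \<Rightarrow> 'k::comm_ring_1 mpoly) \<Rightarrow> bool" where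
  "surjective_matrix n d j j' I J V \<longleftrightarrow>
     (\<forall>k\<in>I. \<forall>l\<in>J. V k l \<in> residue_part n d (j' - j)) \<and>
     (\<forall>g. (\<forall>l\<in>J. g l \<in> residue_part n d j') \<longrightarrow>
        (\<exists>f. (\<forall>k\<in>I. f k \<in> residue_part n d j) \<and> (\<forall>l\<in>J. g l = (\<Sum>k\<in>I. f k * V k l))))"

lemma surjective_matrix_identity: "surjective_matrix n d j j {()} {()} (\<lambda>_ _. 1)"
  by (auto simp: surjective_matrix_def one_in_residue_part)

text \<open>
  The tensor product factors through \<open>V\<close> applied to each of the \<open>I'\<close> copies followed by \<open>W\<close> applied to each of the
  \<open>J\<close> copies.  This is how surjections through an intermediate residue \<open>j'\<close> compose when the numbers of copies do
  not match.
\<close>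

lemma surjective_matrix_tensor:
  fixes V :: "'a \<Rightarrow> 'b \<Rightarrow> 'k::comm_ring_1 mpoly"
  assumes "j \<le> j'" "j' \<le> j''"
    and V: "surjective_matrix n d j j' I J V" and W: "surjective_matrix n d j' j'' I' J' W"
  shows "surjective_matrix n d j j'' (I \<times> I') (J \<times> J') (\<lambda>(k, k') (l, l'). V k l * W k' l')"
  unfolding surjective_matrix_def
proof (intro conjI allI impI ballI)
  fix k l assume "k \<in> I \<times> I'" "l \<in> J \<times> J'"
  moreover have "V k l * W k' l' \<in> residue_part n d (j'' - j)" if "k \<in> I" "k' \<in> I'" "l \<in> J" "l' \<in> J'" for k k' l l'
    using residue_part_mult[of "V k l" n d "j' - j" "W k' l'" "j'' - j'"] that V W assms(1,2)
    by (simp add: surjective_matrix_def)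
  ultimately show "(case k of (k, k') \<Rightarrow> \<lambda>(l, l'). V k l * W k' l') l \<in> residue_part n d (j'' - j)"
    by auto
next
  fix g :: "'b \<times> 'd \<Rightarrow> 'k mpoly"
  assume g: "\<forall>l\<in>J \<times> J'. g l \<in> residue_part n d j''"
  have "\<forall>l\<in>J. \<exists>h. (\<forall>k'\<in>I'. h k' \<in> residue_part n d j') \<and> (\<forall>l'\<in>J'. g (l, l') = (\<Sum>k'\<in>I'. h k' * W k' l'))"
  proof
    fix l assume "l \<in> J"
    then show "\<exists>h. (\<forall>k'\<in>I'. h k' \<in> residue_part n d j') \<and> (\<forall>l'\<in>J'. g (l, l') = (\<Sum>k'\<in>I'. h k' * W k' l'))"
      using W[unfolded surjective_matrix_def, THEN conjunct2, rule_format, of "\<lambda>l'. g (l, l')"] g by simp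
  qed
  from bchoice[OF this] obtain h where h: "\<And>l k'. l \<in> J \<Longrightarrow> k' \<in> I' \<Longrightarrow> h l k' \<in> residue_part n d j'"
    "\<And>l l'. l \<in> J \<Longrightarrow> l' \<in> J' \<Longrightarrow> g (l, l') = (\<Sum>k'\<in>I'. h l k' * W k' l')" by blast
  have "\<forall>k'\<in>I'. \<exists>f. (\<forall>k\<in>I. f k \<in> residue_part n d j) \<and> (\<forall>l\<in>J. h l k' = (\<Sum>k\<in>I. f k * V k l))"
  proof
    fix k' assume "k' \<in> I'"
    then show "\<exists>f. (\<forall>k\<in>I. f k \<in> residue_part n d j) \<and> (\<forall>l\<in>J. h l k' = (\<Sum>k\<in>I. f k * V k l))"
      using V[unfolded surjective_matrix_def, THEN conjunct2, rule_format, of "\<lambda>l. h l k'"] h(1) by simp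
  qed
  from bchoice[OF this] obtain f where f: "\<And>k k'. k \<in> I \<Longrightarrow> k' \<in> I' \<Longrightarrow> f k' k \<in> residue_part n d j"
    "\<And>l k'. l \<in> J \<Longrightarrow> k' \<in> I' \<Longrightarrow> h l k' = (\<Sum>k\<in>I. f k' k * V k l)" by blast
  have "g (l, l') = (\<Sum>(k, k')\<in>I \<times> I'. f k' k * (V k l * W k' l'))" if "l \<in> J" "l' \<in> J'" for l l'
  proof -
    have "g (l, l') = (\<Sum>k'\<in>I'. \<Sum>k\<in>I. f k' k * (V k l * W k' l'))"
      unfolding h(2)[OF that] using that f(2) by (intro sum.cong) (simp_all add: sum_distrib_right mult.assoc)
    also have "\<dots> = (\<Sum>k\<in>I. \<Sum>k'\<in>I'. f k' k * (V k l * W k' l'))" by (rule sum.swap)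
    finally show ?thesis by (simp add: sum.cartesian_product)
  qed
  then show "\<exists>f. (\<forall>k\<in>I \<times> I'. f k \<in> residue_part n d j) \<and>
      (\<forall>l\<in>J \<times> J'. g l = (\<Sum>k\<in>I \<times> I'. f k * (case k of (k, k') \<Rightarrow> \<lambda>(l, l'). V k l * W k' l') l))"
    using f(1) by (intro exI[of _ "\<lambda>(k, k'). f k' k"]) (auto simp: case_prod_unfold)
qed

lemma surjective_matrix_reindex:
  fixes V :: "'a \<Rightarrow> 'b \<Rightarrow> 'k::comm_ring_1 mpoly"
  assumes V: "surjective_matrix n d j j' I J V" and p: "bij_betw p I' I" and q: "bij_betw q J' J"
  shows "surjective_matrix n d j j' I' J' (\<lambda>k l. V (p k) (q l))"
  unfolding surjective_matrix_def
proof (intro conjI allI impI ballI)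
  fix k l assume "k \<in> I'" "l \<in> J'"
  then show "V (p k) (q l) \<in> residue_part n d (j' - j)"
    using V bij_betwE[OF p] bij_betwE[OF q] by (simp add: surjective_matrix_def)
next
  fix g :: "'d \<Rightarrow> 'k mpoly" assume g: "\<forall>l\<in>J'. g l \<in> residue_part n d j'"
  let ?q = "inv_into J' q"
  have "\<forall>l\<in>J. g (?q l) \<in> residue_part n d j'"
    using g bij_betw_inv_into[OF q] by (auto dest: bij_betwE)
  then obtain f where f: "\<forall>k\<in>I. f k \<in> residue_part n d j" "\<forall>l\<in>J. g (?q l) = (\<Sum>k\<in>I. f k * V k l)"
    using V[unfolded surjective_matrix_def, THEN conjunct2, rule_format, of "\<lambda>l. g (?q l)"] by blast
  show "\<exists>f. (\<forall>k\<in>I'. f k \<in> residue_part n d j) \<and> (\<forall>l\<in>J'. g l = (\<Sum>k\<in>I'. f k * V (p k) (q l)))"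
  proof (intro exI[of _ "\<lambda>k. f (p k)"] conjI ballI)
    fix k assume "k \<in> I'"
    then show "f (p k) \<in> residue_part n d j" using f bij_betwE[OF p] by blast
  next
    fix l assume l: "l \<in> J'"
    then have "g l = (\<Sum>k\<in>I. f k * V k (q l))"
      using f(2) bij_betwE[OF q] bij_betw_inv_into_left[OF q] by metis
    also have "\<dots> = (\<Sum>k\<in>I'. f (p k) * V (p k) (q l))"
      by (rule sum.reindex_bij_betw[OF p, symmetric])
    finally show "g l = (\<Sum>k\<in>I'. f (p k) * V (p k) (q l))" .
  qed
qed

definition toeplitz_matrix :: "nat \<Rightarrow> nat \<Rightarrow> nat \<Rightarrow> 'k::comm_ring_1 mpoly" where
  "toeplitz_matrix n k l = (if l \<le> k \<and> k - l < n then xpow (Poly_Mapping.single (k - l) 1) else 0)"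

text \<open>
  The Toeplitz matrix is surjective in its lowest degree because it is triangular there, for the order given by this
  potential.  Replacing a variable \<open>x\<^sub>y\<close> in component \<open>i\<close> by \<open>x\<^sub>z\<close> in component \<open>l\<close>, with \<open>z + l = y + i\<close>, changes
  the quadratic form at a rate of twice the number of remaining variables of index at most \<open>z\<close>, and changes the
  square at a rate of \<open>2 l\<close> in the other direction.  The two rates balance at the component \<open>l\<close> that is the position of
  \<open>x\<^sub>z\<close> among the sorted variables, and convexity makes this the only minimum.  The linear term
  \<open>i\<close> compensates the diagonal contribution \<open>z\<close> of the quadratic form.
\<close>

definition toeplitz_potential :: "nat \<Rightarrow> (nat \<Rightarrow> nat) \<Rightarrow> nat \<Rightarrow> nat" where
  "toeplitz_potential n f i = (\<Sum>u<n. \<Sum>v<n. f u * f v * max u v) + i\<^sup>2 + i"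

lemma toeplitz_potential_increment:
  assumes "z < n"
  shows "toeplitz_potential n (\<lambda>u. f u + (if u = z then 1 else 0)) i
    = (\<Sum>u<n. \<Sum>v<n. f u * f v * max u v) + 2 * (\<Sum>u<n. f u * max z u) + z + i\<^sup>2 + i"
proof -
  let ?e = "\<lambda>u. if u = z then 1 else (0::nat)"
  have 1: "(\<Sum>u<n. \<Sum>v<n. f u * ?e v * max u v) = (\<Sum>u<n. f u * max z u)" for f
  proof (rule sum.cong[OF refl])
    fix u
    have "(\<Sum>v<n. f u * ?e v * max u v) = (\<Sum>v<n. if v = z then f u * max u v else 0)"
      by (intro sum.cong) auto
    then show "(\<Sum>v<n. f u * ?e v * max u v) = f u * max z u" using assms by (simp add: max.commute)
  qed
  have 2: "(\<Sum>u<n. \<Sum>v<n. ?e u * f v * max u v) = (\<Sum>u<n. f u * max z u)"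
    by (subst sum.swap) (use 1 in \<open>simp add: mult.commute max.commute\<close>)
  have 3: "(\<Sum>u<n. \<Sum>v<n. ?e u * ?e v * max u v) = z"
  proof -
    have "(\<Sum>u<n. ?e u * max z u) = (\<Sum>u<n. if u = z then max z u else 0)"
      by (intro sum.cong) auto
    then show ?thesis using assms unfolding 1 by simp
  qed
  have "(\<Sum>u<n. \<Sum>v<n. (f u + ?e u) * (f v + ?e v) * max u v)
      = (\<Sum>u<n. \<Sum>v<n. f u * f v * max u v) + (\<Sum>u<n. \<Sum>v<n. f u * ?e v * max u v)
       + (\<Sum>u<n. \<Sum>v<n. ?e u * f v * max u v) + (\<Sum>u<n. \<Sum>v<n. ?e u * ?e v * max u v)"
    by (simp only: distrib_left distrib_right sum.distrib add.assoc[symmetric])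
  then show ?thesis unfolding toeplitz_potential_def 3 unfolding 1 2 by simp
qed

text \<open>
  The two hypotheses on the partial sums of \<open>f\<close> say that, among the factors of the monomial with exponent \<open>f\<close> times
  \<open>x\<^sub>y\<close>, sorted and counted from \<open>0\<close>, one of those equal to \<open>x\<^sub>y\<close> has position \<open>i\<close>.
\<close>

lemma toeplitz_potential_less:
  assumes "y < n" "z < n" "z + l = y + i" "l \<noteq> i"
    and lower: "(\<Sum>u<y. f u) \<le> i" and upper: "i \<le> (\<Sum>u\<le>y. f u)"
  shows "toeplitz_potential n (\<lambda>u. f u + (if u = y then 1 else 0)) i
    < toeplitz_potential n (\<lambda>u. f u + (if u = z then 1 else 0)) l"
proof -
  let ?S = "\<lambda>w. \<Sum>u<n. int (f u) * int (max w u)"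
  have diff: "?S z - ?S y = (\<Sum>u<n. int (f u) * (int (max z u) - int (max y u)))"
    by (simp add: sum_subtractf algebra_simps)
  have key: "2 * ?S y + int i ^ 2 < 2 * ?S z + int l ^ 2"
  proof (cases "y < z")
    case True
    have "int i * (int z - int y) \<le> int (\<Sum>u\<le>y. f u) * (int z - int y)"
      using upper True by (intro mult_right_mono) (auto simp del: of_nat_sum)
    also have "\<dots> = (\<Sum>u\<le>y. int (f u) * (int z - int y))" by (simp add: sum_distrib_right)
    also have "\<dots> = (\<Sum>u\<le>y. int (f u) * (int (max z u) - int (max y u)))"
      using True by (intro sum.cong) (auto simp: max_def)
    also have "\<dots> \<le> (\<Sum>u<n. int (f u) * (int (max z u) - int (max y u)))"
      using assms(1) True by (intro sum_mono2) auto
    finally have "int i * (int z - int y) \<le> ?S z - ?S y" unfolding diff .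
    moreover have "int z - int y = int i - int l" using assms(3) by linarith
    moreover have "(int i - int l)\<^sup>2 > 0" using assms(4) by simp
    ultimately show ?thesis by (simp add: power2_eq_square algebra_simps)
  next
    case False
    then have zy: "z \<le> y" by simp
    have "(\<Sum>u<n. int (f u) * (int (max y u) - int (max z u)))
        = (\<Sum>u<y. int (f u) * (int (max y u) - int (max z u)))"
      using assms(1) zy by (intro sum.mono_neutral_right) (auto simp: max_def)
    also have "\<dots> \<le> (\<Sum>u<y. int (f u) * (int y - int z))"
      by (intro sum_mono mult_left_mono) (auto simp: max_def)
    also have "\<dots> = int (\<Sum>u<y. f u) * (int y - int z)" by (simp add: sum_distrib_right)
    also have "\<dots> \<le> int i * (int y - int z)"
      using lower zy by (intro mult_right_mono) (auto simp del: of_nat_sum)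
    finally have "?S y - ?S z \<le> int i * (int y - int z)"
      by (simp add: sum_subtractf algebra_simps)
    moreover have "int y - int z = int l - int i" using assms(3) by linarith
    ultimately have "?S y - ?S z \<le> int i * (int l - int i)" by simp
    moreover have "(int i - int l)\<^sup>2 > 0" using assms(4) by simp
    ultimately show ?thesis by (simp add: power2_eq_square algebra_simps)
  qed
  have "int (2 * (\<Sum>u<n. f u * max y u) + i\<^sup>2) < int (2 * (\<Sum>u<n. f u * max z u) + l\<^sup>2)"
    using key by (simp only: of_nat_add of_nat_mult of_nat_sum of_nat_power of_nat_numeral)
  then have "2 * (\<Sum>u<n. f u * max y u) + i\<^sup>2 < 2 * (\<Sum>u<n. f u * max z u) + l\<^sup>2"
    by (simp only: of_nat_less_iff)
  then show ?thesis
    unfolding toeplitz_potential_increment[OF assms(1)] toeplitz_potential_increment[OF assms(2)]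
    using assms(3) by linarith
qed

text \<open>
  In degree \<open>j + 1\<close>, the unit vector with monomial \<open>x\<^sup>m\<close> in component \<open>i\<close> occurs in row \<open>y + i\<close> times \<open>x\<^sup>m / x\<^sub>y\<close>, where
  \<open>x\<^sub>y\<close> is the factor of \<open>x\<^sup>m\<close> at position \<open>i\<close> in sorted order.  All other entries of that multiple are unit vectors of
  larger potential, so induction reaches every unit vector.  In higher degrees the monomials of \<open>M\<close> at residue
  \<open>j + 1\<close> are multiples by monomials of \<open>R\<close> of those of degree \<open>j + 1\<close>; here \<open>j + 1 < d\<close> is essential.
\<close>

lemma surjective_matrix_toeplitz:
  assumes "Suc j < d"
  shows "surjective_matrix n d j (Suc j) {..<n + j} {..<Suc j} (toeplitz_matrix n :: nat \<Rightarrow> nat \<Rightarrow> 'k::comm_ring_1 mpoly)"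
proof -
  let ?V = "toeplitz_matrix n :: nat \<Rightarrow> nat \<Rightarrow> 'k mpoly"
  define P where "P g \<longleftrightarrow> (\<exists>f. (\<forall>k<n + j. f k \<in> residue_part n d j) \<and> (\<forall>l<Suc j. g l = (\<Sum>k<n + j. f k * ?V k l)))"
    for g :: "nat \<Rightarrow> 'k mpoly"
  have P_cong: "P g" if "P g'" "\<And>l. l < Suc j \<Longrightarrow> g l = g' l" for g g'
    using that unfolding P_def by simp
  have P_add: "P (\<lambda>l. g l + g' l)" if g: "P g" "P g'" for g g'
  proof -
    obtain f f' where "\<forall>k<n + j. f k \<in> residue_part n d j" "\<forall>l<Suc j. g l = (\<Sum>k<n + j. f k * ?V k l)"
      "\<forall>k<n + j. f' k \<in> residue_part n d j" "\<forall>l<Suc j. g' l = (\<Sum>k<n + j. f' k * ?V k l)"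
      using g unfolding P_def by blast
    then show ?thesis unfolding P_def
      by (intro exI[of _ "\<lambda>k. f k + f' k"]) (auto simp: distrib_right sum.distrib intro: residue_part_add)
  qed
  have P_mult: "P (\<lambda>l. r * g l)" if g: "P g" and r: "r \<in> residue_part n d 0" for r g
  proof -
    obtain f where "\<forall>k<n + j. f k \<in> residue_part n d j" "\<forall>l<Suc j. g l = (\<Sum>k<n + j. f k * ?V k l)"
      using g unfolding P_def by blast
    then show ?thesis unfolding P_def
      using residue_part_mult[OF r, of _ j]
      by (intro exI[of _ "\<lambda>k. r * f k"]) (auto simp: sum_distrib_left mult.assoc)
  qed
  have P_0: "P (\<lambda>l. 0)"
    unfolding P_def by (intro exI[of _ "\<lambda>_. 0"]) (auto intro: residue_part_0)
  have P_sum: "P (\<lambda>l. \<Sum>x\<in>A. g x l)" if "finite A" "\<And>x. x \<in> A \<Longrightarrow> P (g x)"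
    for A :: "'x set" and g :: "'x \<Rightarrow> nat \<Rightarrow> 'k mpoly"
    using that by (induction A rule: finite_induct) (auto intro: P_0 P_add)
  have P_diff: "P (\<lambda>l. g l - g' l)" if "P g" "P g'" for g g'
    using P_add[OF that(1) P_mult[OF that(2) residue_part_uminus[OF one_in_residue_part]]] by simp
  let ?u = "\<lambda>m i l. if l = i then xpow m else (0 :: 'k mpoly)"
  let ?F = "\<lambda>(m, i). toeplitz_potential n (Poly_Mapping.lookup m) i"
  define D where "D = exponents_of_degree n (Suc j) \<times> {..<Suc j}"
  have finD: "finite D" by (simp add: D_def finite_exponents_of_degree)
  have unit: "P (?u m i)" if "(m, i) \<in> D" for m i
    using that
  proof (induction "Max (?F ` D) - ?F (m, i)" arbitrary: m i rule: less_induct)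
    case less
    then have i: "i < Suc j" and m: "m \<in> exponents n" "monomial_degree m = Suc j"
      by (auto simp: D_def exponents_of_degree_def)
    have total: "(\<Sum>u<n. Poly_Mapping.lookup m u) = Suc j"
      using m by (simp add: monomial_degree_eq_sum)
    then have n: "n > 0" by (cases n) auto
    have "i < (\<Sum>u\<le>n - 1. Poly_Mapping.lookup m u)"
      using total i n by (metis Suc_diff_1 lessThan_Suc_atMost)
    \<comment> \<open>\<open>x\<^sub>y\<close> is the factor of the monomial at position \<open>i\<close>, counted from \<open>0\<close>\<close>
    define y where "y = (LEAST y. i < (\<Sum>u\<le>y. Poly_Mapping.lookup m u))"
    have y: "i < (\<Sum>u\<le>y. Poly_Mapping.lookup m u)" "y \<le> n - 1"
      unfolding y_def using \<open>i < (\<Sum>u\<le>n - 1. Poly_Mapping.lookup m u)\<close> by (rule LeastI, rule Least_le)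
    have y': "(\<Sum>u<y. Poly_Mapping.lookup m u) \<le> i"
    proof (cases y)
      case (Suc y')
      then show ?thesis
        using not_less_Least[of y' "\<lambda>y. i < (\<Sum>u\<le>y. Poly_Mapping.lookup m u)"]
        by (simp add: y_def[symmetric] lessThan_Suc_atMost)
    qed simp
    have yn: "y < n" using y n by simp
    have "(\<Sum>u\<le>y. Poly_Mapping.lookup m u) = (\<Sum>u<y. Poly_Mapping.lookup m u) + Poly_Mapping.lookup m y"
      by (simp flip: lessThan_Suc_atMost)
    then have my: "Poly_Mapping.lookup m y > 0" using y(1) y' by linarith
    define a where "a = m - Poly_Mapping.single y 1"
    have ma: "m = a + Poly_Mapping.single y 1"
      unfolding a_def using my by (intro poly_mapping_eqI) (auto simp: lookup_add lookup_minus lookup_single when_def)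
    have a: "a \<in> exponents n" "monomial_degree a = j"
      using m by (auto simp: ma monomial_degree_add)
    have lm: "Poly_Mapping.lookup (a + Poly_Mapping.single z 1)
        = (\<lambda>u. Poly_Mapping.lookup a u + (if u = z then 1 else 0))" for z
      by (auto simp: fun_eq_iff lookup_add lookup_single when_def)
    \<comment> \<open>removing \<open>x\<^sub>y\<close> lowers the second partial sum by one, so the strict bound becomes a weak one\<close>
    have la: "(\<Sum>u<y. Poly_Mapping.lookup a u) \<le> i" "i \<le> (\<Sum>u\<le>y. Poly_Mapping.lookup a u)"
      using y(1) y' unfolding ma lm by (simp_all add: sum.distrib)
    define k where "k = y + i"
    have k: "k < n + j" using i yn by (simp add: k_def)
    define L where "L = {l. l < Suc j \<and> l \<le> k \<and> k - l < n \<and> l \<noteq> i}"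
    have finL: "finite L" by (simp add: L_def)
    have others: "P (?u (a + Poly_Mapping.single (k - l) 1) l)" if l: "l \<in> L" for l
    proof (rule less.hyps)
      show inD: "(a + Poly_Mapping.single (k - l) 1, l) \<in> D"
        using l a by (auto simp: L_def D_def exponents_of_degree_def monomial_degree_add intro: single_in_exponents)
      have "?F (m, i) < ?F (a + Poly_Mapping.single (k - l) 1, l)"
        unfolding ma prod.case lm
        by (rule toeplitz_potential_less) (use yn l la in \<open>auto simp: L_def k_def\<close>)
      moreover have "?F (a + Poly_Mapping.single (k - l) 1, l) \<le> Max (?F ` D)"
        using finD inD by (intro Max_ge) auto
      ultimately show "Max (?F ` D) - ?F (a + Poly_Mapping.single (k - l) 1, l) < Max (?F ` D) - ?F (m, i)"
        by linarith
    qed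
    have row: "P (\<lambda>l. xpow a * ?V k l)"
      unfolding P_def using k a
      by (intro exI[of _ "\<lambda>k'. if k' = k then xpow a else 0"])
        (auto simp: if_distrib[of "\<lambda>x. x * _"] residue_part_0 intro: single_in_residue_part cong: if_cong)
    show ?case
    proof (rule P_cong[OF P_diff[OF row P_sum[OF finL others]]])
      fix l assume l: "l < Suc j"
      have "(\<Sum>l'\<in>L. ?u (a + Poly_Mapping.single (k - l') 1) l' l)
          = (if l \<in> L then xpow (a + Poly_Mapping.single (k - l) 1) else 0)"
        using finL by (simp add: sum.delta cong: if_cong)
      then show "?u m i l = xpow a * ?V k l - (\<Sum>l'\<in>L. ?u (a + Poly_Mapping.single (k - l') 1) l' l)"
        using l yn by (auto simp: L_def toeplitz_matrix_def xpow_mult k_def ma)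
    qed
  qed
  show ?thesis unfolding surjective_matrix_def
  proof (intro conjI ballI allI impI)
    fix k l show "?V k l \<in> residue_part n d (Suc j - j)"
      by (auto simp: toeplitz_matrix_def residue_part_0 intro!: single_in_residue_part single_in_exponents)
  next
    fix g :: "nat \<Rightarrow> 'k mpoly" assume g: "\<forall>l\<in>{..<Suc j}. g l \<in> residue_part n d (Suc j)"
    have "P (\<lambda>l. if l = i then Poly_Mapping.single m c else 0)"
      if i: "i < Suc j" and m: "m \<in> Poly_Mapping.keys (g i)" for i m c
    proof -
      have m': "m \<in> exponents n" "monomial_degree m mod d = Suc j"
        using residue_part_keysD[of "g i" n d "Suc j" m] g i m assms by auto
      then have "Suc j \<le> monomial_degree m" by (metis mod_less_eq_dividend)
      then obtain m1 m2 where m12: "m = m1 + m2" "m1 \<in> exponents_of_degree n (Suc j)" "m2 \<in> exponents n"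
        using exponent_split[OF m'(1)] by metis
      have "(monomial_degree m2 + Suc j) mod d = (0 + Suc j) mod d"
        using m'(2) m12 assms by (simp add: monomial_degree_add exponents_of_degree_def add.commute)
      then have "monomial_degree m2 mod d = 0 mod d"
        unfolding nat_mod_eq_iff by auto
      then have "Poly_Mapping.single m2 c \<in> residue_part n d 0"
        using m12(3) by (intro single_in_residue_part) auto
      then have "P (\<lambda>l. Poly_Mapping.single m2 c * ?u m1 i l)"
        using i m12 by (intro P_mult unit) (auto simp: D_def)
      then show ?thesis
        by (rule P_cong) (simp add: m12 mult_single add.commute)
    qed
    then have "P (\<lambda>l. \<Sum>i<Suc j. \<Sum>m\<in>Poly_Mapping.keys (g i). if l = i then Poly_Mapping.single m (Poly_Mapping.lookup (g i) m) else 0)"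
      by (intro P_sum) auto
    then have "P g"
    proof (rule P_cong)
      fix l assume l: "l < Suc j"
      have "(\<Sum>i<Suc j. \<Sum>m\<in>Poly_Mapping.keys (g i). if l = i then Poly_Mapping.single m (Poly_Mapping.lookup (g i) m) else 0)
          = (\<Sum>i<Suc j. if l = i then g i else 0)"
        by (intro sum.cong) (auto simp flip: mpoly_expansion)
      then show "g l = (\<Sum>i<Suc j. \<Sum>m\<in>Poly_Mapping.keys (g i). if l = i then Poly_Mapping.single m (Poly_Mapping.lookup (g i) m) else 0)"
        using l by simp
    qed
    then show "\<exists>f. (\<forall>k\<in>{..<n + j}. f k \<in> residue_part n d j) \<and> (\<forall>l\<in>{..<Suc j}. g l = (\<Sum>k<n + j. f k * ?V k l))"
      unfolding P_def by auto
  qed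
qed

text \<open>
  The relation between \<open>r\<close> and \<open>s\<close> says that source and target have equal dimension in degree \<open>c\<close>.
\<close>

lemma surjective_matrix_exists:
  assumes "j \<le> c" "c < d" "n > 0"
  shows "\<exists>r s (V :: nat \<Rightarrow> nat \<Rightarrow> 'k::comm_ring_1 mpoly). r > 0 \<and> surjective_matrix n d j c {..<r} {..<s} V \<and>
    card (exponents_of_degree n j) * r = card (exponents_of_degree n c) * s"
  using assms(1)
proof (induction rule: inc_induct)
  case base
  have "bij_betw (\<lambda>_. ()) {..<Suc 0} {()}" by (auto simp: bij_betw_def inj_on_def)
  from surjective_matrix_reindex[OF surjective_matrix_identity this this]
  show ?case by (intro exI[of _ "Suc 0"]) auto
next
  case (step i)
  then obtain r s and V :: "nat \<Rightarrow> nat \<Rightarrow> 'k mpoly" where r: "r > 0"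
    and V: "surjective_matrix n d (Suc i) c {..<r} {..<s} V"
    and eq: "card (exponents_of_degree n (Suc i)) * r = card (exponents_of_degree n c) * s" by blast
  have T: "surjective_matrix n d i (Suc i) {..<n + i} {..<Suc i} (toeplitz_matrix n :: nat \<Rightarrow> nat \<Rightarrow> 'k mpoly)"
    using step assms by (intro surjective_matrix_toeplitz) auto
  let ?I = "{..<n + i} \<times> {..<r}" and ?J = "{..<Suc i} \<times> {..<s}"
  obtain p p' where p: "bij_betw p {0..<card ?I} ?I" "bij_betw p' {0..<card ?J} ?J"
    using ex_bij_betw_nat_finite[of ?I] ex_bij_betw_nat_finite[of ?J] by auto
  note surjective_matrix_reindex[OF surjective_matrix_tensor[OF _ _ T V] p]
  moreover have "card (exponents_of_degree n i) * ((n + i) * r) = card (exponents_of_degree n c) * (Suc i * s)"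
    using eq card_exponents_of_degree_Suc[of i n] by (metis mult.assoc mult.commute mult.left_commute)
  ultimately show ?case using r step assms(3)
    by (intro exI[of _ "(n + i) * r"] exI[of _ "Suc i * s"]) (auto simp: lessThan_atLeast0 card_cartesian_product)
qed

section \<open>The pushforward of the canonical module along Frobenius\<close>

lemma CHAR_mpoly: "CHAR('k::comm_ring_1 mpoly) = CHAR('k)"
proof (rule CHAR_eqI)
  have of_nat_mpoly: "(of_nat k :: 'k mpoly) = Poly_Mapping.single 0 (of_nat k)" for k
    by (simp only: single_of_nat)
  show "(of_nat CHAR('k) :: 'k mpoly) = 0" by (simp add: of_nat_mpoly del: single_of_nat)
  fix k assume "(of_nat k :: 'k mpoly) = 0"
  then have "Poly_Mapping.lookup (Poly_Mapping.single 0 (of_nat k :: 'k) :: 'k mpoly) 0 = 0"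
    unfolding of_nat_mpoly by simp
  then show "CHAR('k) dvd k" by (simp add: of_nat_eq_0_iff_char_dvd del: single_of_nat)
qed

lemma scale_exponent_zero [simp]: "scale_exponent q 0 = 0"
  by (rule poly_mapping_eqI) simp

lemma lookup_single_mult_shift:
  "Poly_Mapping.lookup (Poly_Mapping.single m c * (f :: 'k::comm_ring_1 mpoly)) (m + k) = c * Poly_Mapping.lookup f k"
  by (subst single_eq_const_mult) (simp add: mult.assoc)

lemma lookup_single_mult_eq_0:
  assumes "\<And>k'. k \<noteq> m + k'"
  shows "Poly_Mapping.lookup (Poly_Mapping.single m c * (f :: 'k::comm_ring_1 mpoly)) k = 0"
  using lookup_xpow_mult_eq_0[OF assms, of f] by (subst single_eq_const_mult) (simp add: mult.assoc)

locale veronese_frobenius =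
  fixes p e n d c :: nat and field_type :: "'k::field itself"
  assumes prime: "prime p" and char: "CHAR('k) = p" and perfect: "surj (\<lambda>x::'k. x ^ p)"
    and n: "n > 0" and d: "d > 0" and c: "c < d" "d dvd c + n"
begin

abbreviation "q \<equiv> p ^ e"

abbreviation "R \<equiv> veronese_ring n d :: 'k mpoly ring"
abbreviation "\<omega> \<equiv> veronese_canonical_module n d :: ('k mpoly, 'k mpoly) module"
abbreviation "F\<omega> \<equiv> frobenius_pushforward R p e \<omega>"

lemma p_pos [simp]: "p > 0" "p \<noteq> 0"
  using prime_gt_0_nat[OF prime] by simp_all

lemma q_pos: "q > 0"
  by simp

lemma canonical_residue: "d dvd k + n \<longleftrightarrow> k mod d = c"
proof -
  obtain r where r: "r < d" "\<And>k. d dvd k + n \<longleftrightarrow> k mod d = r"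
    using residue_class_representative[OF d] by metis
  from r(2)[of c] c have "c = r" by simp
  with r show ?thesis by simp
qed

lemma carrier_R: "carrier R = residue_part n d 0"
  unfolding veronese_carrier residue_part_def by (simp add: dvd_eq_mod_eq_0)

lemma carrier_\<omega>: "carrier \<omega> = residue_part n d c"
  unfolding canonical_carrier residue_part_def canonical_residue using c by simp

lemma R_sel [simp]: "add R = (+)" "monoid.mult R = (*)" "one R = 1" "ring.zero R = 0"
  by (simp_all add: veronese_ring_def)

lemma \<omega>_sel [simp]: "add \<omega> = (+)" "ring.zero \<omega> = 0" "module.smult \<omega> = (*)"
  by (simp_all add: veronese_canonical_module_def)

lemma R_pow [simp]: "r [^]\<^bsub>R\<^esub> (k::nat) = r ^ k"
  by (induction k) (simp_all add: nat_pow_def mult.commute)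

lemma F\<omega>_sel [simp]: "carrier F\<omega> = carrier \<omega>" "add F\<omega> = (+)" "ring.zero F\<omega> = 0"
  "module.smult F\<omega> = (\<lambda>r m. r ^ q * m)"
  by (simp_all add: frobenius_pushforward_def)

lemma frobenius_add: "(f + g :: 'k mpoly) ^ q = f ^ q + g ^ q"
  by (rule freshmans_dream') (simp_all add: CHAR_mpoly char prime)

lemma frobenius_sum: "(\<Sum>x\<in>A. f x :: 'k mpoly) ^ q = (\<Sum>x\<in>A. f x ^ q)"
  by (rule freshmans_dream_sum') (simp_all add: CHAR_mpoly char prime)

lemma scalar_frobenius_add: "(x + y :: 'k) ^ q = x ^ q + y ^ q"
  by (rule freshmans_dream') (simp_all add: char prime)

lemma bij_scalar_frobenius: "bij (\<lambda>x::'k. x ^ q)"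
proof (rule bijI)
  show "inj (\<lambda>x::'k. x ^ q)"
  proof (rule injI)
    fix x y :: 'k assume "x ^ q = y ^ q"
    then have "(x - y) ^ q = 0" using scalar_frobenius_add[of "x - y" y] by simp
    then show "x = y" by simp
  qed
  show "surj (\<lambda>x::'k. x ^ q)"
  proof (induction e)
    case (Suc e)
    have "(\<lambda>x::'k. x ^ p ^ Suc e) = (\<lambda>x. x ^ p) \<circ> (\<lambda>x. x ^ p ^ e)"
      by (simp add: fun_eq_iff power_mult[symmetric] mult.commute)
    then show ?case using comp_surj[OF Suc perfect] by (simp only:)
  qed simp
qed

definition frobenius_root :: "'k \<Rightarrow> 'k" where
  "frobenius_root = inv_into UNIV (\<lambda>x. x ^ q)"

lemma frobenius_root_power [simp]: "frobenius_root (x ^ q) = x"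
  unfolding frobenius_root_def by (rule inv_f_f) (rule bij_is_inj[OF bij_scalar_frobenius])

lemma power_frobenius_root [simp]: "frobenius_root x ^ q = x"
  unfolding frobenius_root_def by (rule surj_f_inv_f[of "\<lambda>x. x ^ q"]) (rule bij_is_surj[OF bij_scalar_frobenius])

lemma frobenius_root_0 [simp]: "frobenius_root 0 = 0"
  using frobenius_root_power[of 0] q_pos by (simp add: power_0_left)

lemma frobenius_root_add: "frobenius_root (x + y) = frobenius_root x + frobenius_root y"
  by (metis frobenius_root_power power_frobenius_root scalar_frobenius_add)

lemma frobenius_root_mult: "frobenius_root (x ^ q * y) = x * frobenius_root y"
  by (metis frobenius_root_power power_frobenius_root power_mult_distrib)

lemma module_F\<omega>: "Module.module R F\<omega>"
proof -
  have closed: "r ^ q * m \<in> carrier \<omega>" if "r \<in> carrier R" "m \<in> carrier \<omega>" for r m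
    using that residue_part_mult[of "r ^ q" n d 0 m c] residue_part_power_eq[of r n d 0 q]
    unfolding carrier_R carrier_\<omega> by simp
  interpret \<omega>: Module.module R \<omega> by (rule canonical_module)
  have ab: "abelian_group F\<omega>"
  proof (rule abelian_groupI)
    fix x assume "x \<in> carrier F\<omega>"
    then show "\<exists>y\<in>carrier F\<omega>. y \<oplus>\<^bsub>F\<omega>\<^esub> x = \<zero>\<^bsub>F\<omega>\<^esub>"
      by (intro bexI[of _ "- x"]) (auto simp: carrier_\<omega> intro: residue_part_uminus)
  qed (auto simp: carrier_\<omega> residue_part_0 add_ac intro: residue_part_add)
  show ?thesis
    by (rule moduleI)
      (simp_all add: veronese_cring ab closed frobenius_add distrib_left distrib_right power_mult_distrib mult.assoc)
qed

definition slots :: "((nat \<Rightarrow>\<^sub>0 nat) \<times> nat) set" where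
  "slots = {(a, j). a \<in> exponent_box n q \<and> j < d \<and> d dvd monomial_degree a + q * j + n}"

lemma card_slots: "card slots = q ^ n"
  unfolding slots_def by (rule card_box_residue_pairs[OF q_pos n d])

lemma finite_slots: "finite slots"
  by (rule finite_subset[of _ "exponent_box n q \<times> {..<d}"]) (auto simp: slots_def finite_exponent_box)

text \<open>
  The coefficient of \<open>x\<^sup>a\<close> over the subring of \<open>q\<close>-th powers, with the \<open>q\<close>-th root taken, and cut down to degrees
  congruent to \<open>j\<close>.
\<close>

definition slot_part :: "(nat \<Rightarrow>\<^sub>0 nat) \<Rightarrow> nat \<Rightarrow> 'k mpoly \<Rightarrow> 'k mpoly" where
  "slot_part a j f = Abs_poly_mapping (\<lambda>m. if monomial_degree m mod d = j mod d
     then frobenius_root (Poly_Mapping.lookup f (scale_exponent q m + a)) else 0)"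

lemma lookup_slot_part: "Poly_Mapping.lookup (slot_part a j f) m = (if monomial_degree m mod d = j mod d
     then frobenius_root (Poly_Mapping.lookup f (scale_exponent q m + a)) else 0)"
proof -
  have inj: "inj (\<lambda>m. scale_exponent q m + a)"
  proof (rule injI)
    fix m m' assume "scale_exponent q m + a = scale_exponent q m' + a"
    then have "scale_exponent q m = scale_exponent q m'" by simp
    then have "q * Poly_Mapping.lookup m i = q * Poly_Mapping.lookup m' i" for i
      by (metis lookup_scale_exponent)
    then show "m = m'" using q_pos by (intro poly_mapping_eqI) simp
  qed
  have "finite ((\<lambda>m. scale_exponent q m + a) -` Poly_Mapping.keys f)"
    by (rule finite_vimageI[OF finite_keys inj])
  then have "finite {m. (if monomial_degree m mod d = j mod d
     then frobenius_root (Poly_Mapping.lookup f (scale_exponent q m + a)) else 0) \<noteq> 0}"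
    by (rule rev_finite_subset) (auto simp: in_keys_iff split: if_splits intro: ccontr)
  then show ?thesis unfolding slot_part_def by simp
qed

lemma slot_part_add: "slot_part a j (f + g) = slot_part a j f + slot_part a j g"
  by (rule poly_mapping_eqI) (simp add: lookup_slot_part lookup_add frobenius_root_add)

lemma slot_part_0 [simp]: "slot_part a j 0 = 0"
  by (rule poly_mapping_eqI) (simp add: lookup_slot_part)

lemma slot_part_sum: "slot_part a j (\<Sum>x\<in>A. f x) = (\<Sum>x\<in>A. slot_part a j (f x))"
  by (induction A rule: infinite_finite_induct) (simp_all add: slot_part_add)

lemma slot_part_in_residue_part:
  assumes "f \<in> polynomials n"
  shows "slot_part a j f \<in> residue_part n d j"
  unfolding residue_part_def polynomials_iff_exponents
proof (intro CollectI conjI subsetI ballI)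
  fix m assume m: "m \<in> Poly_Mapping.keys (slot_part a j f)"
  then show "monomial_degree m mod d = j mod d"
    by (auto simp: in_keys_iff lookup_slot_part split: if_splits)
  have "scale_exponent q m + a \<in> Poly_Mapping.keys f"
    using m by (auto simp: in_keys_iff lookup_slot_part split: if_splits intro: ccontr)
  then have "scale_exponent q m \<in> exponents n" using assms unfolding polynomials_iff_exponents by auto
  then show "m \<in> exponents n" using scale_in_exponents_iff[OF q_pos] by simp
qed

text \<open>
  This holds because the degrees in \<open>r\<close> are divisible by \<open>d\<close>, so that multiplication by \<open>r\<close> respects the cut to
  degrees congruent to \<open>j\<close>, and because the entries of \<open>a\<close> are below \<open>q\<close>, so that no carry occurs.
\<close>

lemma slot_part_frobenius_linear:
  assumes "a \<in> exponent_box n q" "r \<in> residue_part n d 0"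
  shows "slot_part a j (r ^ q * f) = r * slot_part a j f"
proof -
  have single: "slot_part a j (Poly_Mapping.single m x ^ q * f) = Poly_Mapping.single m x * slot_part a j f"
    if m: "monomial_degree m mod d = 0" for m x
  proof (rule poly_mapping_eqI)
    fix k
    show "Poly_Mapping.lookup (slot_part a j (Poly_Mapping.single m x ^ q * f)) k
      = Poly_Mapping.lookup (Poly_Mapping.single m x * slot_part a j f) k"
    proof (cases "\<exists>k'. k = m + k'")
      case True
      then obtain k' where k: "k = m + k'" by blast
      have "monomial_degree k mod d = monomial_degree k' mod d"
        using m unfolding k monomial_degree_add by (metis add_0 mod_add_left_eq)
      moreover have "scale_exponent q k + a = scale_exponent q m + (scale_exponent q k' + a)"
        by (simp add: k scale_exponent_add add.assoc)
      ultimately show ?thesis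
        unfolding lookup_slot_part single_power
        by (simp add: k lookup_single_mult_shift lookup_slot_part frobenius_root_mult)
    next
      case False
      \<comment> \<open>no carry: \<open>q m \<le> q k + a\<close> already forces \<open>m \<le> k\<close>\<close>
      have "scale_exponent q k + a \<noteq> scale_exponent q m + k'" for k'
      proof
        assume eq: "scale_exponent q k + a = scale_exponent q m + k'"
        have "Poly_Mapping.lookup m i \<le> Poly_Mapping.lookup k i" for i
        proof -
          have "q * Poly_Mapping.lookup m i \<le> q * Poly_Mapping.lookup k i + Poly_Mapping.lookup a i"
            using arg_cong[OF eq, of "\<lambda>m. Poly_Mapping.lookup m i"] by (simp add: lookup_add)
          also have "\<dots> < q * Suc (Poly_Mapping.lookup k i)"
            using assms(1) by (simp add: exponent_box_def)
          finally show ?thesis by (simp only: mult_less_cancel1 less_Suc_eq_le)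
        qed
        then have "k = m + (k - m)" by (intro poly_mapping_eqI) (simp add: lookup_add lookup_minus)
        with False show False by blast
      qed
      then show ?thesis using False
        unfolding lookup_slot_part single_power
        by (simp add: lookup_single_mult_eq_0)
    qed
  qed
  have "slot_part a j (r ^ q * f)
      = (\<Sum>m\<in>Poly_Mapping.keys r. slot_part a j (Poly_Mapping.single m (Poly_Mapping.lookup r m) ^ q * f))"
    by (subst mpoly_expansion[of r]) (simp only: frobenius_sum sum_distrib_right slot_part_sum)
  also have "\<dots> = (\<Sum>m\<in>Poly_Mapping.keys r. Poly_Mapping.single m (Poly_Mapping.lookup r m) * slot_part a j f)"
    using residue_part_keysD[OF assms(2)] by (intro sum.cong refl single) simp
  also have "\<dots> = r * slot_part a j f"
    by (subst (3) mpoly_expansion[of r]) (simp only: sum_distrib_right)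
  finally show ?thesis .
qed

lemma slot_part_of_slot:
  assumes "(a, j) \<in> slots" "(a', j') \<in> slots" "h \<in> residue_part n d j'"
  shows "slot_part a j (xpow a' * h ^ q) = (if a = a' \<and> j = j' then h else 0)"
proof (rule poly_mapping_eqI)
  fix k
  have box: "a \<in> exponent_box n q" "a' \<in> exponent_box n q" "j < d" "j' < d"
    using assms by (auto simp: slots_def)
  have "xpow a' * h ^ q = (\<Sum>m\<in>Poly_Mapping.keys h. Poly_Mapping.single (scale_exponent q m + a') (Poly_Mapping.lookup h m ^ q))"
    by (subst mpoly_expansion[of h]) (simp only: frobenius_sum sum_distrib_left single_power mult_single mult_1 add.commute)
  then have "Poly_Mapping.lookup (xpow a' * h ^ q) (scale_exponent q k + a)
      = (\<Sum>m\<in>Poly_Mapping.keys h. if scale_exponent q m + a' = scale_exponent q k + a then Poly_Mapping.lookup h m ^ q else 0)"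
    by (simp add: lookup_sum lookup_single when_def)
  also have "\<dots> = (\<Sum>m\<in>Poly_Mapping.keys h. if m = k then (if a = a' then Poly_Mapping.lookup h k ^ q else 0) else 0)"
    using exponent_division_unique[OF box(2,1)] by (intro sum.cong refl) metis
  also have "\<dots> = (if a = a' then Poly_Mapping.lookup h k ^ q else 0)"
    using q_pos by (simp add: in_keys_iff power_0_left)
  finally have l: "Poly_Mapping.lookup (xpow a' * h ^ q) (scale_exponent q k + a)
      = (if a = a' then Poly_Mapping.lookup h k ^ q else 0)" .
  have "Poly_Mapping.lookup h k = 0" if "monomial_degree k mod d \<noteq> j'"
    using residue_part_keysD[OF assms(3), of k] that box by (auto simp: in_keys_iff)
  then show "Poly_Mapping.lookup (slot_part a j (xpow a' * h ^ q)) k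
      = Poly_Mapping.lookup (if a = a' \<and> j = j' then h else 0) k"
    using box by (auto simp: lookup_slot_part l)
qed

lemma slot_in_carrier:
  assumes "(a, j) \<in> slots" "h \<in> residue_part n d j"
  shows "xpow a * h ^ q \<in> carrier \<omega>"
proof -
  have "a \<in> exponents n" "d dvd (monomial_degree a + q * j) + n"
    using assms by (auto simp: slots_def exponent_box_def)
  then have "(monomial_degree a + q * j) mod d = c mod d" unfolding canonical_residue using c by simp
  moreover have "xpow a \<in> residue_part n d (monomial_degree a)"
    using \<open>a \<in> exponents n\<close> by (rule single_in_residue_part) simp
  ultimately show ?thesis
    unfolding carrier_\<omega> using residue_part_mult[OF _ residue_part_power_eq[OF assms(2), of q], of "xpow a"]
    by (metis residue_part_cong)
qed

lemma monomial_slot: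
  assumes "b \<in> exponents n" "monomial_degree b mod d = c"
  obtains a m where "b = scale_exponent q m + a" "m \<in> exponents n" "a \<in> exponent_box n q"
    "(a, monomial_degree m mod d) \<in> slots"
proof -
  obtain a m where am: "a \<in> exponent_box n q" "m \<in> exponents n" "b = scale_exponent q m + a"
    using exponent_division[OF assms(1) q_pos] by blast
  have "(monomial_degree a + q * (monomial_degree m mod d)) mod d = monomial_degree b mod d"
    unfolding am(3) monomial_degree_add monomial_degree_scale by (metis add.commute mod_add_right_eq mod_mult_right_eq)
  then have "d dvd monomial_degree a + q * (monomial_degree m mod d) + n"
    unfolding canonical_residue using assms(2) by simp
  then show ?thesis using am d that by (simp add: slots_def)
qed

lemma slot_decomposition:
  assumes "f \<in> carrier \<omega>"
  shows "f = (\<Sum>(a, j)\<in>slots. xpow a * slot_part a j f ^ q)"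
proof -
  let ?T = "\<lambda>f. \<Sum>(a, j)\<in>slots. xpow a * slot_part a j f ^ q"
  have T_sum: "?T (\<Sum>x\<in>A. g x) = (\<Sum>x\<in>A. ?T (g x))" for A :: "(nat \<Rightarrow>\<^sub>0 nat) set" and g
    unfolding slot_part_sum frobenius_sum sum_distrib_left case_prod_unfold by (rule sum.swap)
  have single: "?T (Poly_Mapping.single b x) = Poly_Mapping.single b x"
    if b: "b \<in> exponents n" "monomial_degree b mod d = c" for b x
  proof -
    obtain a m where am: "b = scale_exponent q m + a" "m \<in> exponents n" "(a, monomial_degree m mod d) \<in> slots"
      using monomial_slot[OF b] by blast
    let ?h = "Poly_Mapping.single m (frobenius_root x)" and ?j = "monomial_degree m mod d"
    have h: "?h \<in> residue_part n d ?j" using am by (intro single_in_residue_part) auto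
    have x: "Poly_Mapping.single b x = xpow a * ?h ^ q"
      by (simp add: am(1) single_power mult_single add.commute)
    have "?T (Poly_Mapping.single b x) = (\<Sum>s\<in>slots. if s = (a, ?j) then xpow a * ?h ^ q else 0)"
      unfolding x
    proof (rule sum.cong[OF refl])
      fix s assume s: "s \<in> slots"
      obtain a' j' where s': "s = (a', j')" by force
      show "(case s of (a', j') \<Rightarrow> xpow a' * slot_part a' j' (xpow a * ?h ^ q) ^ q)
          = (if s = (a, ?j) then xpow a * ?h ^ q else 0)"
        using slot_part_of_slot[OF _ am(3) h, of a' j'] s q_pos by (auto simp: s' power_0_left)
    qed
    then show ?thesis using am(3) finite_slots by (simp add: x)
  qed
  have "?T f = (\<Sum>b\<in>Poly_Mapping.keys f. ?T (Poly_Mapping.single b (Poly_Mapping.lookup f b)))"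
    by (subst mpoly_expansion[of f]) (rule T_sum)
  also have "\<dots> = (\<Sum>b\<in>Poly_Mapping.keys f. Poly_Mapping.single b (Poly_Mapping.lookup f b))"
    using residue_part_keysD[of f n d c] assms c by (intro sum.cong refl single) (auto simp: carrier_\<omega>)
  finally show ?thesis by (simp flip: mpoly_expansion)
qed

end

section \<open>The rank of the pushforward\<close>

text \<open>
  Gaussian elimination without division.  The coefficients stay in the subring \<open>A\<close>, which matters for the rank over
  \<open>R\<close>: elimination over the fraction field of \<open>S\<close> would only give coefficients in \<open>S\<close>.
\<close>

lemma subring_linear_dependence:
  fixes A :: "'a::idom set" and v :: "'i \<Rightarrow> 'b \<Rightarrow> 'a"
  assumes A: "0 \<in> A" "1 \<in> A" "\<And>x y. x \<in> A \<Longrightarrow> y \<in> A \<Longrightarrow> x + y \<in> A"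
      "\<And>x y. x \<in> A \<Longrightarrow> y \<in> A \<Longrightarrow> x * y \<in> A" "\<And>x. x \<in> A \<Longrightarrow> - x \<in> A"
    and "finite J" "finite I" "card J < card I" "\<And>i b. i \<in> I \<Longrightarrow> b \<in> J \<Longrightarrow> v i b \<in> A"
  shows "\<exists>c. (\<forall>i\<in>I. c i \<in> A) \<and> (\<exists>i\<in>I. c i \<noteq> 0) \<and> (\<forall>b\<in>J. (\<Sum>i\<in>I. c i * v i b) = 0)"
  using assms(6-9)
proof (induction J arbitrary: I v rule: finite_induct)
  case empty
  then show ?case using A(2) by (intro exI[of _ "\<lambda>_. 1"]) (auto simp: card_gt_0_iff)
next
  case (insert b J)
  show ?case
  proof (cases "\<forall>i\<in>I. v i b = 0")
    case True
    have "\<exists>c. (\<forall>i\<in>I. c i \<in> A) \<and> (\<exists>i\<in>I. c i \<noteq> 0) \<and> (\<forall>b\<in>J. (\<Sum>i\<in>I. c i * v i b) = 0)"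
      using insert.hyps insert.prems by (intro insert.IH) auto
    then show ?thesis using True by auto
  next
    case False
    then obtain k where k: "k \<in> I" "v k b \<noteq> 0" by blast
    let ?I = "I - {k}"
    let ?w = "\<lambda>i b'. v k b * v i b' - v i b * v k b'"
    have diff: "x - y \<in> A" if "x \<in> A" "y \<in> A" for x y
      using A(3)[OF that(1) A(5)[OF that(2)]] by simp
    have sum_A: "sum g S \<in> A" if "\<And>x. x \<in> S \<Longrightarrow> g x \<in> A" for S :: "'i set" and g
      using that by (induction S rule: infinite_finite_induct) (auto intro: A)
    have "\<exists>c. (\<forall>i\<in>?I. c i \<in> A) \<and> (\<exists>i\<in>?I. c i \<noteq> 0) \<and> (\<forall>b'\<in>J. (\<Sum>i\<in>?I. c i * ?w i b') = 0)"
      using insert.hyps insert.prems k by (intro insert.IH) (auto intro!: diff A(4))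
    then obtain c where c: "\<forall>i\<in>?I. c i \<in> A" "\<exists>i\<in>?I. c i \<noteq> 0" "\<forall>b'\<in>J. (\<Sum>i\<in>?I. c i * ?w i b') = 0"
      by blast
    \<comment> \<open>the coefficient at the pivot \<open>k\<close> is chosen to cancel column \<open>b\<close>\<close>
    define c' where "c' i = (if i = k then - (\<Sum>i\<in>?I. c i * v i b) else c i * v k b)" for i
    have sum_c': "(\<Sum>i\<in>I. c' i * v i b') = (\<Sum>i\<in>?I. c i * ?w i b')" for b'
    proof -
      have "(\<Sum>i\<in>I. c' i * v i b') = c' k * v k b' + (\<Sum>i\<in>?I. c' i * v i b')"
        using k insert.prems by (simp add: sum.remove)
      also have "(\<Sum>i\<in>?I. c' i * v i b') = (\<Sum>i\<in>?I. c i * v k b * v i b')"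
        by (intro sum.cong) (auto simp: c'_def)
      finally show ?thesis
        by (simp add: c'_def sum_distrib_right sum_subtractf right_diff_distrib mult.assoc)
    qed
    show ?thesis
    proof (intro exI[of _ c'] conjI ballI)
      fix i assume "i \<in> I"
      then show "c' i \<in> A"
        using c(1) k insert.prems by (auto simp: c'_def intro!: A(4,5) sum_A)
    next
      show "\<exists>i\<in>I. c' i \<noteq> 0" using c(2) k by (auto simp: c'_def)
    next
      fix b' assume "b' \<in> insert b J"
      then show "(\<Sum>i\<in>I. c' i * v i b') = 0"
        unfolding sum_c' using c(3) by (auto simp: mult.commute)
    qed
  qed
qed

context veronese_frobenius
begin

lemma finsum_F\<omega>:
  assumes "finite A" "\<And>x. x \<in> A \<Longrightarrow> f x \<in> carrier \<omega>"
  shows "finsum F\<omega> f A = sum f A"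
proof -
  interpret F\<omega>: Module.module R F\<omega> by (rule module_F\<omega>)
  show ?thesis using assms
    by (induction A rule: finite_induct) (simp_all add: Pi_iff)
qed

lemma lincomb_F\<omega>:
  assumes "finite A" "A \<subseteq> carrier \<omega>" "a \<in> A \<rightarrow> carrier R"
  shows "module.lincomb F\<omega> a A = (\<Sum>x\<in>A. a x ^ q * x)"
proof -
  interpret F\<omega>: Module.module R F\<omega> by (rule module_F\<omega>)
  have "a x ^ q * x \<in> carrier \<omega>" if "x \<in> A" for x
    using F\<omega>.smult_closed[of "a x" x] that assms by auto
  then show ?thesis
    unfolding F\<omega>.lincomb_def using finsum_F\<omega>[OF assms(1)] by simp
qed

lemma lin_dep_F\<omega>_iff:
  assumes "B \<subseteq> carrier \<omega>"
  shows "module.lin_dep R F\<omega> B \<longleftrightarrow>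
    (\<exists>A a v. finite A \<and> A \<subseteq> B \<and> (\<forall>x\<in>A. a x \<in> residue_part n d 0) \<and> (\<Sum>x\<in>A. a x ^ q * x) = 0 \<and> v \<in> A \<and> a v \<noteq> 0)"
proof -
  have "finite A \<and> A \<subseteq> B \<and> a \<in> A \<rightarrow> carrier R \<and> module.lincomb F\<omega> a A = \<zero>\<^bsub>F\<omega>\<^esub> \<and> v \<in> A \<and> a v \<noteq> \<zero>\<^bsub>R\<^esub> \<longleftrightarrow>
      finite A \<and> A \<subseteq> B \<and> (\<forall>x\<in>A. a x \<in> residue_part n d 0) \<and> (\<Sum>x\<in>A. a x ^ q * x) = 0 \<and> v \<in> A \<and> a v \<noteq> 0"
    for A a v
    using lincomb_F\<omega>[of A a] assms by (auto simp: carrier_R Pi_iff)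
  then show ?thesis unfolding module.lin_dep_def[OF module_F\<omega>] by simp
qed

text \<open>
  Each \<open>M\<^sub>j\<close> contains \<open>x\<^sub>0\<^sup>j\<close>, and multiplication by \<open>x\<^sub>0\<close> to the power \<open>d - j\<close> embeds it into \<open>R\<close>.  So the pushforward contains, and
  is embedded in, a free \<open>R\<close>-module with one generator for every slot.
\<close>

lemma module_rank_F\<omega>: "module_rank R F\<omega> = q ^ n"
  unfolding module_rank_def
proof (rule Greatest_equality)
  define elt where "elt s = (xpow (fst s) * xpow (Poly_Mapping.single 0 (snd s)) ^ q :: 'k mpoly)"
    for s :: "(nat \<Rightarrow>\<^sub>0 nat) \<times> nat"
  have x0: "(xpow (Poly_Mapping.single 0 j) :: 'k mpoly) \<in> residue_part n d j" for j
    using n by (intro single_in_residue_part single_in_exponents) auto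
  have part: "slot_part a j (elt s) = (if s = (a, j) then xpow (Poly_Mapping.single 0 j) else 0)"
    if "(a, j) \<in> slots" "s \<in> slots" for a j s
    using slot_part_of_slot[OF that(1) _ x0, of "fst s" "snd s"] that(2)
    by (cases s) (auto simp: elt_def)
  have inj: "inj_on elt slots"
  proof (rule inj_onI)
    fix s t assume s: "s \<in> slots" "t \<in> slots" "elt s = elt t"
    obtain a j where aj: "s = (a, j)" by force
    have "slot_part a j (elt s) \<noteq> 0" using part[of a j s] s aj by simp
    then have "slot_part a j (elt t) \<noteq> 0" unfolding s(3) .
    moreover have "(a, j) \<in> slots" using s(1) aj by simp
    ultimately show "s = t" using part[OF _ s(2), of a j] unfolding aj by argo
  qed
  have carr: "elt ` slots \<subseteq> carrier \<omega>"
    using slot_in_carrier x0 by (auto simp: elt_def)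
  have "\<not> module.lin_dep R F\<omega> (elt ` slots)"
    unfolding lin_dep_F\<omega>_iff[OF carr]
  proof
    assume "\<exists>A a v. finite A \<and> A \<subseteq> elt ` slots \<and> (\<forall>x\<in>A. a x \<in> residue_part n d 0) \<and>
      (\<Sum>x\<in>A. a x ^ q * x) = 0 \<and> v \<in> A \<and> a v \<noteq> 0"
    then obtain A a v where A: "finite A" "A \<subseteq> elt ` slots" "\<forall>x\<in>A. a x \<in> residue_part n d 0"
      "(\<Sum>x\<in>A. a x ^ q * x) = 0" "v \<in> A" "a v \<noteq> 0" by blast
    obtain b j where v: "(b, j) \<in> slots" "v = elt (b, j)" using A(2,5) by force
    have "0 = slot_part b j (\<Sum>x\<in>A. a x ^ q * x)" using A(4) by simp
    also have "\<dots> = (\<Sum>x\<in>A. a x * slot_part b j x)"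
      unfolding slot_part_sum using A(3) v(1)
      by (intro sum.cong) (auto simp: slots_def slot_part_frobenius_linear)
    also have "\<dots> = (\<Sum>x\<in>A. if x = v then a v * xpow (Poly_Mapping.single 0 j) else 0)"
    proof (rule sum.cong[OF refl])
      fix x assume "x \<in> A"
      then obtain s where s: "s \<in> slots" "x = elt s" using A(2) by blast
      then show "a x * slot_part b j x = (if x = v then a v * xpow (Poly_Mapping.single 0 j) else 0)"
        using part[OF v(1) s(1)] inj_onD[OF inj, of s "(b, j)"] v by auto
    qed
    also have "\<dots> = a v * xpow (Poly_Mapping.single 0 j)" using A(1,5) by simp
    finally show False using A(6) by simp
  qed
  show "\<exists>B. finite B \<and> B \<subseteq> carrier F\<omega> \<and> \<not> module.lin_dep R F\<omega> B \<and> card B = q ^ n"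
    using \<open>\<not> module.lin_dep R F\<omega> (elt ` slots)\<close> carr finite_slots inj card_slots
    by (intro exI[of _ "elt ` slots"]) (simp add: card_image)
next
  fix k assume "\<exists>B. finite B \<and> B \<subseteq> carrier F\<omega> \<and> \<not> module.lin_dep R F\<omega> B \<and> card B = k"
  then obtain B where B: "finite B" "B \<subseteq> carrier \<omega>" "\<not> module.lin_dep R F\<omega> B" "card B = k" by auto
  show "k \<le> q ^ n"
  proof (rule ccontr)
    assume "\<not> k \<le> q ^ n"
    then have card: "card slots < card B" using B card_slots by simp
    let ?v = "\<lambda>f (a, j). xpow (Poly_Mapping.single 0 (d - j)) * slot_part a j f"
    have v: "?v f s \<in> residue_part n d 0" if "f \<in> B" "s \<in> slots" for f s
    proof -
      obtain a j where s: "s = (a, j)" by force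
      have "f \<in> polynomials n" using that B by (auto simp: carrier_\<omega> residue_part_def)
      moreover have "(xpow (Poly_Mapping.single 0 (d - j)) :: 'k mpoly) \<in> residue_part n d (d - j)"
        using n by (intro single_in_residue_part single_in_exponents) auto
      ultimately have "?v f s \<in> residue_part n d (d - j + j)"
        unfolding s prod.case by (intro residue_part_mult slot_part_in_residue_part)
      moreover have "(d - j + j) mod d = 0 mod d" using that(2) s by (auto simp: slots_def)
      ultimately show ?thesis using residue_part_cong by blast
    qed
    have mult: "f * g \<in> residue_part n d 0" if "f \<in> residue_part n d 0" "g \<in> residue_part n d 0"
      for f g :: "'k mpoly"
      using residue_part_mult[OF that] by simp
    have "\<exists>a. (\<forall>f\<in>B. a f \<in> residue_part n d 0) \<and> (\<exists>f\<in>B. a f \<noteq> 0) \<and>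
        (\<forall>s\<in>slots. (\<Sum>f\<in>B. a f * ?v f s) = 0)"
      by (rule subring_linear_dependence[of "residue_part n d 0 :: 'k mpoly set", OF residue_part_0
            one_in_residue_part residue_part_add mult residue_part_uminus finite_slots B(1) card v])
    then obtain a where a: "\<forall>f\<in>B. a f \<in> residue_part n d 0" "\<exists>f\<in>B. a f \<noteq> 0"
      "\<forall>s\<in>slots. (\<Sum>f\<in>B. a f * ?v f s) = 0" by blast
    let ?f = "\<Sum>f\<in>B. a f ^ q * f"
    interpret F\<omega>: Module.module R F\<omega> by (rule module_F\<omega>)
    have "a f ^ q * f \<in> carrier \<omega>" if "f \<in> B" for f
      using F\<omega>.smult_closed[of "a f" f] that a(1) B(2) by (auto simp: carrier_R)
    then have f: "?f \<in> carrier \<omega>" unfolding carrier_\<omega> by (intro residue_part_sum)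
    have "slot_part b j ?f = 0" if "(b, j) \<in> slots" for b j
    proof -
      have "xpow (Poly_Mapping.single 0 (d - j)) * slot_part b j ?f = (\<Sum>f\<in>B. a f * ?v f (b, j))"
        unfolding slot_part_sum sum_distrib_left using that a(1)
        by (intro sum.cong) (auto simp: slots_def slot_part_frobenius_linear mult.left_commute)
      then show ?thesis using a(3) that by auto
    qed
    then have "?f = 0"
      using q_pos by (subst slot_decomposition[OF f]) (auto intro!: sum.neutral simp: power_0_left)
    then have "module.lin_dep R F\<omega> B"
      unfolding lin_dep_F\<omega>_iff[OF B(2)] using B(1) a(1,2) by blast
    with B(3) show False by blast
  qed
qed

section \<open>The upper bound\<close>

definition slot_count :: "nat \<Rightarrow> nat" where
  "slot_count j = card {a \<in> exponent_box n q. d dvd monomial_degree a + (q * j + n)}"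

lemma slot_count_bounds:
  "real q ^ n / real d - real q ^ (n - 1) \<le> real (slot_count j)"
  "real (slot_count j) \<le> real q ^ n / real d + real q ^ (n - 1)"
  unfolding slot_count_def by (rule card_box_residue_bounds[OF q_pos n d])+

text \<open>
  An \<open>R\<close>-linear map from \<open>M\<^sub>j\<close> to \<open>M\<^sub>c\<close>, here the restriction of \<open>\<psi>\<close> to the copy of \<open>M\<^sub>j\<close> at \<open>x\<^sup>a\<close>, satisfies
  \<open>g \<psi>(f) = f \<psi>(g)\<close>.  Let \<open>c < j < d\<close>; then \<open>n \<ge> 2\<close>, since \<open>n = 1\<close> gives \<open>c = d - 1\<close>.  With \<open>f = x\<^sub>0\<^sup>j\<close> and \<open>g = x\<^sub>1\<^sup>j\<close> it follows that
  \<open>\<psi>(x\<^sub>0\<^sup>j)\<close> is divisible by \<open>x\<^sub>0\<^sup>j\<close>, which leaves no room in degree \<open>c\<close>; the other monomials follow by comparing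
  them with \<open>x\<^sub>0\<^sup>j\<close>.  If the degree of \<open>x\<^sup>m\<close> is at least \<open>d\<close>, a monomial of degree \<open>d\<close> can be pulled out of \<open>\<psi>\<close>.
\<close>

lemma low_degree_vanishing:
  assumes \<psi>: "\<And>f. f \<in> carrier \<omega> \<Longrightarrow> \<psi> f \<in> carrier \<omega>"
      "\<And>r f. r \<in> carrier R \<Longrightarrow> f \<in> carrier \<omega> \<Longrightarrow> \<psi> (r ^ q * f) = r * \<psi> f"
    and a: "a \<in> exponents n" and m: "m \<in> exponents n" "c < monomial_degree m"
    and am: "(q * monomial_degree m + monomial_degree a) mod d = c"
    and \<mu>: "monomial_degree \<mu> = c"
  shows "Poly_Mapping.lookup (\<psi> (xpow (scale_exponent q m + a))) \<mu> = 0"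
proof -
  define E where "E m' = \<psi> (xpow (scale_exponent q m' + a))" for m'
  have in_\<omega>: "xpow (scale_exponent q m' + a) \<in> carrier \<omega>"
    if "m' \<in> exponents n" "monomial_degree m' mod d = monomial_degree m mod d" for m'
  proof -
    have "(q * monomial_degree m' + monomial_degree a) mod d = (q * monomial_degree m + monomial_degree a) mod d"
      using that(2) by (metis mod_add_left_eq mod_mult_right_eq)
    then show ?thesis
      unfolding carrier_\<omega> using am a that(1) c
      by (intro single_in_residue_part) (auto simp: monomial_degree_add intro: scale_in_exponents)
  qed
  have E_shift: "E (m1 + m') = xpow m1 * E m'"
    if "m1 \<in> exponents n" "monomial_degree m1 = d" "m' \<in> exponents n"
      "monomial_degree m' mod d = monomial_degree m mod d" for m1 m'
  proof -
    have "xpow (scale_exponent q (m1 + m') + a) = xpow m1 ^ q * xpow (scale_exponent q m' + a)"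
      by (simp add: single_power xpow_mult scale_exponent_add add.assoc)
    moreover have "xpow m1 \<in> carrier R"
      unfolding carrier_R using that by (intro single_in_residue_part) auto
    ultimately show ?thesis
      unfolding E_def using \<psi>(2) in_\<omega>[OF that(3,4)] by metis
  qed
  have "Poly_Mapping.lookup (E m) \<mu> = 0"
  proof (cases "d \<le> monomial_degree m")
    case True
    then obtain m1 m2 where m12: "m = m1 + m2" "m1 \<in> exponents_of_degree n d" "m2 \<in> exponents n"
      using exponent_split[OF m(1)] by metis
    then have "E m = xpow m1 * E m2"
      by (auto simp: exponents_of_degree_def monomial_degree_add intro!: E_shift)
    moreover have "\<mu> \<noteq> m1 + k" for k
      using m12(2) \<mu> c by (auto simp: exponents_of_degree_def monomial_degree_add)
    ultimately show ?thesis using lookup_xpow_mult_eq_0 by metis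
  next
    case False
    define j where "j = monomial_degree m"
    have j: "c < j" "j < d" using False m by (auto simp: j_def)
    have n2: "1 < n"
    proof (rule ccontr)
      assume "\<not> 1 < n"
      then have "n = 1" using n by simp
      then have "d \<le> c + 1" using c by (auto dest: dvd_imp_le)
      with j show False by simp
    qed
    \<comment> \<open>\<open>x\<^sub>0\<close> to the power \<open>d - j\<close> turns monomials of degree \<open>j\<close> into elements of \<open>R\<close> and cancels afterwards\<close>
    let ?h = "Poly_Mapping.single 0 (d - j)"
    have h: "?h \<in> exponents n" using n by (intro single_in_exponents)
    have exchange: "xpow m' * E m'' = xpow m'' * E m'"
      if "m' \<in> exponents_of_degree n j" "m'' \<in> exponents_of_degree n j" for m' m''
    proof -
      have "xpow (m' + ?h) * E m'' = E ((m' + ?h) + m'')"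
        using that h j by (intro E_shift[symmetric]) (auto simp: exponents_of_degree_def monomial_degree_add j_def)
      also have "(m' + ?h) + m'' = (m'' + ?h) + m'" by (simp add: add_ac)
      also have "E ((m'' + ?h) + m') = xpow (m'' + ?h) * E m'"
        using that h j by (intro E_shift) (auto simp: exponents_of_degree_def monomial_degree_add j_def)
      finally have "xpow ?h * (xpow m' * E m'') = xpow ?h * (xpow m'' * E m')"
        by (simp add: xpow_mult mult.assoc[symmetric] add.commute)
      then show ?thesis by simp
    qed
    let ?e0 = "Poly_Mapping.single 0 j" and ?e1 = "Poly_Mapping.single 1 j"
    have e: "?e0 \<in> exponents_of_degree n j" "?e1 \<in> exponents_of_degree n j" "m \<in> exponents_of_degree n j"
      using n n2 m by (auto simp: exponents_of_degree_def j_def intro: single_in_exponents)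
    have E0: "Poly_Mapping.lookup (E ?e0) \<nu> = 0" if \<nu>: "monomial_degree \<nu> = c" for \<nu>
    proof -
      have "?e1 + \<nu> \<noteq> ?e0 + k" for k
      proof
        assume "?e1 + \<nu> = ?e0 + k"
        then have "Poly_Mapping.lookup (?e1 + \<nu>) 0 = Poly_Mapping.lookup (?e0 + k) 0" by simp
        then have "j \<le> Poly_Mapping.lookup \<nu> 0" by (simp add: lookup_add lookup_single_not_eq)
        with lookup_le_monomial_degree[of \<nu> 0] \<nu> j show False by simp
      qed
      then have "Poly_Mapping.lookup (xpow ?e1 * E ?e0) (?e1 + \<nu>) = 0"
        unfolding exchange[OF e(2,1)] by (rule lookup_xpow_mult_eq_0)
      then show ?thesis by simp
    qed
    have "Poly_Mapping.lookup (xpow ?e0 * E m) (?e0 + \<mu>) = 0"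
    proof (cases "\<exists>k. ?e0 + \<mu> = m + k")
      case True
      then obtain k where k: "?e0 + \<mu> = m + k" by blast
      then have "monomial_degree (?e0 + \<mu>) = monomial_degree (m + k)" by simp
      then have "monomial_degree k = c" using \<mu> by (simp add: monomial_degree_add j_def)
      then show ?thesis unfolding exchange[OF e(1,3)] k by (simp add: E0)
    next
      case False
      then show ?thesis unfolding exchange[OF e(1,3)] by (intro lookup_xpow_mult_eq_0) blast
    qed
    then show ?thesis by simp
  qed
  then show ?thesis by (simp add: E_def)
qed

text \<open>
  If the bound failed, the vectors in degree \<open>c\<close> that come from the monomials in \<open>G\<close>, those at which low degrees do
  not vanish, would be too few to span, so a nonzero linear form \<open>\<Lambda>\<close> on degree \<open>c\<close> would vanish on all of them.  It would
  then vanish on the whole image, since scalars pass through the map as \<open>q\<close>-th roots.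
\<close>

lemma surjection_upper_bound:
  assumes \<phi>: "\<phi> \<in> LinearCombinations.module_hom R F\<omega> (direct_power N \<omega>)"
    and surj: "\<phi> ` carrier F\<omega> = carrier (direct_power N \<omega>)"
  shows "N * card (exponents_of_degree n c) \<le> (\<Sum>j\<le>c. slot_count j * card (exponents_of_degree n j))"
proof (rule ccontr)
  assume less: "\<not> ?thesis"
  let ?T = "{..<N} \<times> exponents_of_degree n c"
  define S where "S j = {a \<in> exponent_box n q. d dvd monomial_degree a + (q * j + n)}" for j
  define G where "G = (\<Union>j\<le>c. (\<lambda>(m, a). scale_exponent q m + a) ` (exponents_of_degree n j \<times> S j))"
  have finS: "finite (S j)" for j using finite_exponent_box by (simp add: S_def)
  have finG: "finite G"
    unfolding G_def using finS finite_exponents_of_degree by blast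
  have finT: "finite ?T" using finite_exponents_of_degree by blast
  have "card G \<le> (\<Sum>j\<le>c. card ((\<lambda>(m, a). scale_exponent q m + a) ` (exponents_of_degree n j \<times> S j)))"
    unfolding G_def by (rule card_UN_le) simp
  also have "\<dots> \<le> (\<Sum>j\<le>c. card (exponents_of_degree n j \<times> S j))"
    by (intro sum_mono card_image_le) (simp add: finS finite_exponents_of_degree)
  also have "\<dots> = (\<Sum>j\<le>c. slot_count j * card (exponents_of_degree n j))"
    by (simp add: card_cartesian_product slot_count_def S_def mult.commute)
  also have "\<dots> < card ?T" using less by (simp add: card_cartesian_product)
  finally have card: "card G < card ?T" .
  have \<phi>_carr: "\<phi> f l \<in> carrier \<omega>" if "f \<in> carrier \<omega>" "l < N" for f l
    using \<phi> that by (auto simp: LinearCombinations.module_hom_def direct_power_def)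
  have \<phi>_add: "\<phi> (f + g) l = \<phi> f l + \<phi> g l" if "f \<in> carrier \<omega>" "g \<in> carrier \<omega>" "l < N" for f g l
    using \<phi> that by (auto simp: LinearCombinations.module_hom_def direct_power_def)
  have \<phi>_smult: "\<phi> (r ^ q * f) l = r * \<phi> f l" if "r \<in> carrier R" "f \<in> carrier \<omega>" "l < N" for r f l
    using \<phi> that by (auto simp: LinearCombinations.module_hom_def direct_power_def)
  have "\<exists>x. (\<forall>t\<in>?T. x t \<in> (UNIV :: 'k set)) \<and> (\<exists>t\<in>?T. x t \<noteq> 0) \<and>
      (\<forall>b\<in>G. (\<Sum>t\<in>?T. x t * Poly_Mapping.lookup (\<phi> (xpow b) (fst t)) (snd t)) = 0)"
    by (rule subring_linear_dependence) (use finG finT card in auto)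
  then obtain x where x: "\<exists>t\<in>?T. x t \<noteq> (0::'k)"
    "\<And>b. b \<in> G \<Longrightarrow> (\<Sum>t\<in>?T. x t * Poly_Mapping.lookup (\<phi> (xpow b) (fst t)) (snd t)) = 0" by blast
  define \<Lambda> where "\<Lambda> f = (\<Sum>t\<in>?T. x t * Poly_Mapping.lookup (\<phi> f (fst t)) (snd t))" for f
  have \<Lambda>_add: "\<Lambda> (f + g) = \<Lambda> f + \<Lambda> g" if "f \<in> carrier \<omega>" "g \<in> carrier \<omega>" for f g
    unfolding \<Lambda>_def sum.distrib[symmetric]
    by (intro sum.cong) (auto simp: \<phi>_add[OF that] lookup_add distrib_left)
  have const: "Poly_Mapping.single 0 y \<in> carrier R" for y
    unfolding carrier_R by (intro single_in_residue_part) auto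
  have \<Lambda>_smult: "\<Lambda> (Poly_Mapping.single 0 y ^ q * f) = y * \<Lambda> f" if "f \<in> carrier \<omega>" for y f
    unfolding \<Lambda>_def sum_distrib_left
    by (intro sum.cong) (auto simp: \<phi>_smult[OF const that])
  have \<Lambda>_xpow: "\<Lambda> (xpow b) = 0" if b: "b \<in> exponents n" "monomial_degree b mod d = c" for b
  proof -
    obtain a m where am: "b = scale_exponent q m + a" "m \<in> exponents n" "a \<in> exponent_box n q"
      using monomial_slot[OF b] by blast
    show ?thesis
    proof (cases "monomial_degree m \<le> c")
      case True
      have "d dvd monomial_degree a + (q * monomial_degree m + n)"
        using canonical_residue[of "monomial_degree b"] b(2) am(1) by (simp add: monomial_degree_add add_ac)
      then have "b \<in> G"
        unfolding G_def using True am
        by (intro UN_I[of "monomial_degree m"] image_eqI[of _ _ "(m, a)"]) (auto simp: S_def exponents_of_degree_def)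
      then show ?thesis using x(2) by (simp add: \<Lambda>_def)
    next
      case False
      have "Poly_Mapping.lookup (\<phi> (xpow b) l) \<mu> = 0" if "l < N" "\<mu> \<in> exponents_of_degree n c" for l \<mu>
        unfolding am(1)
        by (rule low_degree_vanishing[of "\<lambda>f. \<phi> f l"])
          (use that \<phi>_carr \<phi>_smult am False b in \<open>auto simp: exponents_of_degree_def exponent_box_def monomial_degree_add\<close>)
      then show ?thesis unfolding \<Lambda>_def by (intro sum.neutral) auto
    qed
  qed
  have xpow_carr: "Poly_Mapping.single b y \<in> carrier \<omega>" if "b \<in> exponents n" "monomial_degree b mod d = c" for b y
    unfolding carrier_\<omega> using that c by (intro single_in_residue_part) auto
  have \<Lambda>_single: "\<Lambda> (Poly_Mapping.single b y) = 0" if b: "b \<in> exponents n" "monomial_degree b mod d = c" for b y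
  proof -
    have "Poly_Mapping.single b y = Poly_Mapping.single 0 (frobenius_root y) ^ q * xpow b"
      by (simp add: single_power mult_single)
    then show ?thesis using \<Lambda>_smult[OF xpow_carr[OF b]] \<Lambda>_xpow[OF b] by simp
  qed
  have \<Lambda>_0: "\<Lambda> f = 0" if f: "f \<in> carrier \<omega>" for f
  proof -
    have keys: "b \<in> exponents n \<and> monomial_degree b mod d = c" if "b \<in> Poly_Mapping.keys f" for b
      using residue_part_keysD[of f n d c b] f that c by (simp add: carrier_\<omega>)
    have zero: "\<Lambda> 0 = 0" using \<Lambda>_smult[of 0 0] by (simp add: carrier_\<omega> residue_part_0)
    have "\<Lambda> (\<Sum>b\<in>A. Poly_Mapping.single b (Poly_Mapping.lookup f b)) = 0"
      if "finite A" "A \<subseteq> Poly_Mapping.keys f" for A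
      using that
    proof (induction A rule: finite_induct)
      case (insert b A)
      have "(\<Sum>b\<in>A. Poly_Mapping.single b (Poly_Mapping.lookup f b)) \<in> carrier \<omega>"
        unfolding carrier_\<omega> using insert.prems keys xpow_carr
        by (intro residue_part_sum) (auto simp: carrier_\<omega>)
      then show ?case
        using insert keys[of b] by (simp add: \<Lambda>_add xpow_carr \<Lambda>_single)
    qed (simp add: zero)
    from this[OF finite_keys order_refl] show ?thesis by (simp flip: mpoly_expansion)
  qed
  obtain l \<mu> where l: "l < N" "\<mu> \<in> exponents_of_degree n c" "x (l, \<mu>) \<noteq> 0" using x(1) by auto
  let ?y = "\<lambda>i\<in>{..<N}. if i = l then xpow \<mu> else (0 :: 'k mpoly)"
  have "xpow \<mu> \<in> carrier \<omega>" using l c by (intro xpow_carr) (auto simp: exponents_of_degree_def)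
  then have "?y \<in> carrier (direct_power N \<omega>)"
    by (auto simp: direct_power_def carrier_\<omega> residue_part_0)
  then have "?y \<in> \<phi> ` carrier \<omega>" using surj by simp
  then obtain f where f: "f \<in> carrier \<omega>" "\<phi> f = ?y" by (elim imageE) simp
  have "\<Lambda> f = (\<Sum>t\<in>?T. if t = (l, \<mu>) then x (l, \<mu>) else 0)"
    unfolding \<Lambda>_def f(2) by (intro sum.cong) (auto simp: lookup_single when_def)
  also have "\<dots> = x (l, \<mu>)" using finT l by simp
  finally show False using \<Lambda>_0[OF f(1)] l(3) by simp
qed

section \<open>The lower bound\<close>

text \<open>
  For each \<open>j \<le> c\<close>, the slots \<open>(a, j)\<close> are cut into \<open>slot_count j div r j\<close> blocks of \<open>r j\<close>, with fewer than \<open>r j\<close> left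
  over, and \<open>V j\<close> is applied to every block.  Distinct blocks use distinct slots, so preimages can be
  chosen independently.
\<close>

lemma surjection_exists:
  fixes r s :: "nat \<Rightarrow> nat" and V :: "nat \<Rightarrow> nat \<Rightarrow> nat \<Rightarrow> 'k mpoly"
  assumes V: "\<And>j. j \<le> c \<Longrightarrow> surjective_matrix n d j c {..<r j} {..<s j} (V j)"
  defines "N \<equiv> (\<Sum>j\<le>c. (slot_count j div r j) * s j)"
  shows "\<exists>\<phi> \<in> LinearCombinations.module_hom R F\<omega> (direct_power N \<omega>).
    \<phi> ` carrier F\<omega> = carrier (direct_power N \<omega>)"
proof -
  define k where "k j = slot_count j div r j" for j
  define S where "S j = {a \<in> exponent_box n q. d dvd monomial_degree a + (q * j + n)}" for j
  have finS: "finite (S j)" for j using finite_exponent_box by (simp add: S_def)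
  \<comment> \<open>a component is a triple: residue \<open>j\<close>, number of the block, column of \<open>V j\<close>\<close>
  define L where "L = (SIGMA j:{..c}. {..<k j} \<times> {..<s j})"
  have "card L = N" by (simp add: L_def N_def k_def card_SigmaI card_cartesian_product)
  then obtain \<beta> where \<beta>: "bij_betw \<beta> {..<N} L"
    using ex_bij_betw_nat_finite[of L] by (auto simp: L_def lessThan_atLeast0)
  have "\<exists>\<alpha>. \<alpha> ` ({..<k j} \<times> {..<r j}) \<subseteq> S j \<and> inj_on \<alpha> ({..<k j} \<times> {..<r j})" for j
  proof -
    have "card ({..<k j} \<times> {..<r j}) \<le> card (S j)"
      by (simp add: k_def card_cartesian_product slot_count_def S_def[symmetric] div_times_less_eq_dividend)
    then show ?thesis
      using inj_on_iff_card_le[of "{..<k j} \<times> {..<r j}" "S j"] finS by auto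
  qed
  then obtain \<alpha> where \<alpha>: "\<And>j. \<alpha> j ` ({..<k j} \<times> {..<r j}) \<subseteq> S j"
    "\<And>j. inj_on (\<alpha> j) ({..<k j} \<times> {..<r j})" by metis
  have slot: "(\<alpha> j (u, v), j) \<in> slots" if "j \<le> c" "u < k j" "v < r j" for j u v
    using \<alpha>(1)[of j] that c by (fastforce simp: S_def slots_def add.assoc)
  define \<Phi> where "\<Phi> f j u l = (\<Sum>v<r j. slot_part (\<alpha> j (u, v)) j f * V j v l)" for f j u l
  define \<phi> where "\<phi> f = (\<lambda>i\<in>{..<N}. case \<beta> i of (j, u, l) \<Rightarrow> \<Phi> f j u l)" for f
  have \<beta>_in: "j \<le> c \<and> u < k j \<and> l < s j" if "i < N" "\<beta> i = (j, u, l)" for i j u l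
  proof -
    have "\<beta> i \<in> L" using bij_betwE[OF \<beta>] that(1) by blast
    then show ?thesis using that(2) by (simp add: L_def)
  qed
  have \<Phi>_carr: "\<Phi> f j u l \<in> carrier \<omega>" if "f \<in> carrier \<omega>" "j \<le> c" "l < s j" for f j u l
  proof -
    have "slot_part (\<alpha> j (u, v)) j f * V j v l \<in> residue_part n d (j + (c - j))" if "v < r j" for v
      using \<open>f \<in> carrier \<omega>\<close> V[OF \<open>j \<le> c\<close>] that \<open>l < s j\<close>
      by (intro residue_part_mult slot_part_in_residue_part)
        (auto simp: carrier_\<omega> residue_part_def[of n d c] surjective_matrix_def)
    then show ?thesis
      unfolding \<Phi>_def carrier_\<omega> using \<open>j \<le> c\<close> by (intro residue_part_sum) simp
  qed
  have \<phi>_carr: "\<phi> f \<in> carrier (direct_power N \<omega>)" if "f \<in> carrier \<omega>" for f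
    using \<Phi>_carr[OF that] \<beta>_in by (auto simp: \<phi>_def direct_power_def split: prod.splits)
  have "\<phi> \<in> LinearCombinations.module_hom R F\<omega> (direct_power N \<omega>)"
    unfolding LinearCombinations.module_hom_def
  proof (intro CollectI conjI allI impI)
    show "\<phi> \<in> carrier F\<omega> \<rightarrow> carrier (direct_power N \<omega>)" using \<phi>_carr by simp
    fix f g assume "f \<in> carrier F\<omega> \<and> g \<in> carrier F\<omega>"
    show "\<phi> (f \<oplus>\<^bsub>F\<omega>\<^esub> g) = \<phi> f \<oplus>\<^bsub>direct_power N \<omega>\<^esub> \<phi> g"
      by (auto simp: \<phi>_def \<Phi>_def direct_power_def slot_part_add distrib_right sum.distrib
          split: prod.splits intro!: restrict_ext)
  next
    fix x f assume x: "x \<in> carrier R \<and> f \<in> carrier F\<omega>"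
    have "\<Phi> (x ^ q * f) j u l = x * \<Phi> f j u l" if "j \<le> c" "u < k j" for j u l
      unfolding \<Phi>_def sum_distrib_left
    proof (rule sum.cong[OF refl])
      fix v assume "v \<in> {..<r j}"
      then have "\<alpha> j (u, v) \<in> exponent_box n q" using slot[OF that] by (auto simp: slots_def)
      then show "slot_part (\<alpha> j (u, v)) j (x ^ q * f) * V j v l = x * (slot_part (\<alpha> j (u, v)) j f * V j v l)"
        using x by (simp add: slot_part_frobenius_linear carrier_R mult.assoc)
    qed
    then show "\<phi> (x \<odot>\<^bsub>F\<omega>\<^esub> f) = x \<odot>\<^bsub>direct_power N \<omega>\<^esub> \<phi> f"
      using \<beta>_in by (auto simp: \<phi>_def direct_power_def split: prod.splits intro!: restrict_ext)
  qed
  moreover have "\<phi> ` carrier F\<omega> = carrier (direct_power N \<omega>)"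
  proof (intro equalityI subsetI)
    fix y assume "y \<in> \<phi> ` carrier F\<omega>"
    then show "y \<in> carrier (direct_power N \<omega>)" using \<phi>_carr by auto
  next
    fix y assume y: "y \<in> carrier (direct_power N \<omega>)"
    define g where "g j u l = y (inv_into {..<N} \<beta> (j, u, l))" for j u l
    have g_carr: "g j u l \<in> residue_part n d c" if "j \<le> c" "u < k j" "l < s j" for j u l
    proof -
      have "inv_into {..<N} \<beta> (j, u, l) \<in> {..<N}"
        using bij_betwE[OF bij_betw_inv_into[OF \<beta>]] that by (auto simp: L_def)
      then show ?thesis using y by (auto simp: g_def direct_power_def carrier_\<omega> PiE_iff)
    qed
    define Q where "Q j u h \<longleftrightarrow> (\<forall>v<r j. h v \<in> residue_part n d j) \<and>
        (\<forall>l<s j. g j u l = (\<Sum>v<r j. h v * V j v l))" for j u h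
    have "\<exists>h. j \<le> c \<and> u < k j \<longrightarrow> Q j u h" for j u
    proof (cases "j \<le> c \<and> u < k j")
      case True
      then show ?thesis
        using V[of j, unfolded surjective_matrix_def, THEN conjunct2, rule_format, of "g j u"] g_carr[of j u]
        by (auto simp: Ball_def Q_def)
    qed auto
    then obtain h where "\<And>j u. j \<le> c \<and> u < k j \<longrightarrow> Q j u (h j u)" by metis
    then have h: "\<And>j u v. j \<le> c \<Longrightarrow> u < k j \<Longrightarrow> v < r j \<Longrightarrow> h j u v \<in> residue_part n d j"
      "\<And>j u l. j \<le> c \<Longrightarrow> u < k j \<Longrightarrow> l < s j \<Longrightarrow> g j u l = (\<Sum>v<r j. h j u v * V j v l)"
      unfolding Q_def by blast+
    define W where "W = (SIGMA j:{..c}. {..<k j} \<times> {..<r j})"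
    have finW: "finite W" by (simp add: W_def)
    define f where "f = (\<Sum>(j, u, v)\<in>W. xpow (\<alpha> j (u, v)) * h j u v ^ q)"
    have f_carr: "f \<in> carrier \<omega>"
      unfolding f_def carrier_\<omega>
      by (rule residue_part_sum)
        (auto simp: W_def intro!: slot_in_carrier[unfolded carrier_\<omega>, OF slot h(1)])
    have part: "slot_part (\<alpha> j (u, v)) j f = h j u v" if w: "j \<le> c" "u < k j" "v < r j" for j u v
    proof -
      have "slot_part (\<alpha> j (u, v)) j f = (\<Sum>w\<in>W. if w = (j, u, v) then h j u v else 0)"
        unfolding f_def slot_part_sum
      proof (rule sum.cong[OF refl])
        fix w assume "w \<in> W"
        then obtain j' u' v' where w': "w = (j', u', v')" "j' \<le> c" "u' < k j'" "v' < r j'"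
          by (auto simp: W_def)
        have "\<alpha> j (u, v) = \<alpha> j' (u', v') \<and> j = j' \<longleftrightarrow> w = (j, u, v)"
          using inj_onD[OF \<alpha>(2)[of j], of "(u, v)" "(u', v')"] w w' by auto
        then show "slot_part (\<alpha> j (u, v)) j (case w of (j, u, v) \<Rightarrow> xpow (\<alpha> j (u, v)) * h j u v ^ q)
            = (if w = (j, u, v) then h j u v else 0)"
          using slot_part_of_slot[OF slot[OF w] slot[OF w'(2-4)] h(1)[OF w'(2-4)]] w'(1) by auto
      qed
      also have "\<dots> = h j u v" using finW w by (simp add: W_def)
      finally show ?thesis .
    qed
    have "\<phi> f = y"
    proof
      fix i show "\<phi> f i = y i"
      proof (cases "i < N")
        case True
        obtain j u l where \<beta>i: "\<beta> i = (j, u, l)" by (cases "\<beta> i") auto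
        note b = \<beta>_in[OF True \<beta>i]
        have "\<phi> f i = g j u l"
          using True \<beta>i b part h(2)[of j u l] by (simp add: \<phi>_def \<Phi>_def)
        also have "\<dots> = y i"
          using bij_betw_inv_into_left[OF \<beta>, of i] True \<beta>i by (simp add: g_def)
        finally show ?thesis .
      next
        case False
        then show ?thesis using y by (auto simp: \<phi>_def direct_power_def PiE_iff extensional_def)
      qed
    qed
    then show "y \<in> \<phi> ` carrier F\<omega>" using f_carr by auto
  qed
  ultimately show ?thesis by blast
qed

section \<open>The limit\<close>

lemma max_surjection_rank_upper:
  "max_surjection_rank R F\<omega> \<omega> * card (exponents_of_degree n c)
    \<le> (\<Sum>j\<le>c. slot_count j * card (exponents_of_degree n j))"
    (is "_ \<le> ?X")
  and max_surjection_rank_lower: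
  "\<lbrakk>\<phi> \<in> LinearCombinations.module_hom R F\<omega> (direct_power N \<omega>);
    \<phi> ` carrier F\<omega> = carrier (direct_power N \<omega>)\<rbrakk> \<Longrightarrow> N \<le> max_surjection_rank R F\<omega> \<omega>"
proof -
  let ?P = "\<lambda>N. \<exists>\<phi> \<in> LinearCombinations.module_hom R F\<omega> (direct_power N \<omega>).
    \<phi> ` carrier F\<omega> = carrier (direct_power N \<omega>)"
  have bound: "N \<le> ?X" if "?P N" for N
  proof -
    from that have "N * card (exponents_of_degree n c) \<le> ?X" using surjection_upper_bound by blast
    moreover have "N * 1 \<le> N * card (exponents_of_degree n c)"
      using card_exponents_of_degree_pos[OF n, of c] by (intro mult_left_mono) auto
    ultimately show ?thesis by linarith
  qed
  show "N \<le> max_surjection_rank R F\<omega> \<omega>"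
    if "\<phi> \<in> LinearCombinations.module_hom R F\<omega> (direct_power N \<omega>)"
      "\<phi> ` carrier F\<omega> = carrier (direct_power N \<omega>)"
    unfolding max_surjection_rank_def by (rule Greatest_le_nat[OF _ bound]) (use that in blast)
  \<comment> \<open>the greatest element exists only if some surjection does; the one onto the zero module serves\<close>
  have "?P 0"
  proof (intro bexI[of _ "\<lambda>_ _. undefined"])
    have "0 \<in> carrier \<omega>" by (simp add: carrier_\<omega> residue_part_0)
    then show "(\<lambda>_ _. undefined) ` carrier F\<omega> = carrier (direct_power 0 \<omega>)"
      by (auto simp: direct_power_def)
  qed (auto simp: LinearCombinations.module_hom_def direct_power_def restrict_def)
  from GreatestI_nat[of ?P, OF this bound] have "?P (max_surjection_rank R F\<omega> \<omega>)"
    unfolding max_surjection_rank_def .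
  then show "max_surjection_rank R F\<omega> \<omega> * card (exponents_of_degree n c) \<le> ?X"
    using surjection_upper_bound by blast
qed

lemma surjection_ratio_bounds:
  fixes r s :: "nat \<Rightarrow> nat" and V :: "nat \<Rightarrow> nat \<Rightarrow> nat \<Rightarrow> 'k mpoly"
  assumes V: "\<And>j. j \<le> c \<Longrightarrow> surjective_matrix n d j c {..<r j} {..<s j} (V j)"
    and r: "\<And>j. j \<le> c \<Longrightarrow> r j > 0"
    and rs: "\<And>j. j \<le> c \<Longrightarrow> card (exponents_of_degree n j) * r j = card (exponents_of_degree n c) * s j"
  defines "\<rho> \<equiv> real (n + c) / real n"
    and "ratio \<equiv> real (max_surjection_rank R F\<omega> \<omega>) / real (module_rank R F\<omega>)"
  shows "\<rho> * (1 / real d - 1 / real q) - (\<Sum>j\<le>c. real (s j)) / real q \<le> ratio"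
    and "ratio \<le> \<rho> * (1 / real d + 1 / real q)"
proof -
  let ?D = "\<lambda>j. real (card (exponents_of_degree n j))"
  let ?b = "real (max_surjection_rank R F\<omega> \<omega>)"
  have Dc: "?D c > 0" using card_exponents_of_degree_pos[OF n] by simp
  have \<rho>: "(\<Sum>j\<le>c. ?D j / ?D c) = \<rho>"
  proof -
    have "real n * (\<Sum>j\<le>c. ?D j) = real (n + c) * ?D c"
      using arg_cong[OF sum_card_exponents_of_degree[of n c], of real] by simp
    then have "(\<Sum>j\<le>c. ?D j) / ?D c = \<rho>"
      using n Dc by (simp add: \<rho>_def field_simps)
    then show ?thesis by (simp add: sum_divide_distrib)
  qed
  have ratio: "ratio = ?b / real q ^ n" by (simp add: ratio_def module_rank_F\<omega>)
  have q: "real q > 0" "real q ^ n > 0" by simp_all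
  have qn: "real q ^ (n - 1) / real q ^ n = 1 / real q"
    using n by (cases n) auto
  have "?b * ?D c \<le> (\<Sum>j\<le>c. real (slot_count j) * ?D j)"
    using max_surjection_rank_upper by (simp flip: of_nat_mult of_nat_sum)
  also have "\<dots> \<le> (\<Sum>j\<le>c. (real q ^ n / real d + real q ^ (n - 1)) * ?D j)"
    by (intro sum_mono mult_right_mono slot_count_bounds) simp
  finally have "?b \<le> (\<Sum>j\<le>c. (real q ^ n / real d + real q ^ (n - 1)) * ?D j) / ?D c"
    using Dc by (simp add: pos_le_divide_eq)
  also have "\<dots> = (real q ^ n / real d + real q ^ (n - 1)) * \<rho>"
    unfolding \<rho>[symmetric] by (simp add: sum_distrib_left sum_divide_distrib)
  finally have "ratio \<le> (real q ^ n / real d + real q ^ (n - 1)) * \<rho> / real q ^ n"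
    unfolding ratio using q by (intro divide_right_mono) auto
  also have "\<dots> = \<rho> * (1 / real d + real q ^ (n - 1) / real q ^ n)"
    using q by (simp add: field_simps)
  finally show "ratio \<le> \<rho> * (1 / real d + 1 / real q)" unfolding qn .
  let ?N = "\<Sum>j\<le>c. (slot_count j div r j) * s j"
  obtain \<phi> where "\<phi> \<in> LinearCombinations.module_hom R F\<omega> (direct_power ?N \<omega>)"
    "\<phi> ` carrier F\<omega> = carrier (direct_power ?N \<omega>)"
    using surjection_exists[OF V] by blast
  then have "?N \<le> max_surjection_rank R F\<omega> \<omega>" by (rule max_surjection_rank_lower)
  then have N: "real ?N \<le> ?b" by (simp only: of_nat_le_iff)
  have summand: "?D j / ?D c * (real q ^ n / real d - real q ^ (n - 1)) - real (s j)
      \<le> real (slot_count j div r j) * real (s j)" if j: "j \<le> c" for j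
  proof -
    have "?D j * real (r j) = ?D c * real (s j)"
      using rs[OF j] by (simp flip: of_nat_mult)
    then have sj: "real (s j) = ?D j / ?D c * real (r j)" using Dc by (simp add: field_simps)
    have "real (slot_count j) \<le> (real (slot_count j div r j) + 1) * real (r j)"
    proof -
      have "slot_count j \<le> (slot_count j div r j + 1) * r j"
        using dividend_less_times_div[OF r[OF j], of "slot_count j"] by (simp add: algebra_simps)
      then show ?thesis by (metis of_nat_1 of_nat_add of_nat_le_iff of_nat_mult)
    qed
    then have "real q ^ n / real d - real q ^ (n - 1) \<le> (real (slot_count j div r j) + 1) * real (r j)"
      using slot_count_bounds(1)[of j] by linarith
    then have "?D j / ?D c * (real q ^ n / real d - real q ^ (n - 1))
        \<le> ?D j / ?D c * ((real (slot_count j div r j) + 1) * real (r j))"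
      by (intro mult_left_mono) auto
    also have "\<dots> = (real (slot_count j div r j) + 1) * real (s j)"
      unfolding sj by simp
    finally show ?thesis by (simp add: algebra_simps)
  qed
  have "\<rho> * (real q ^ n / real d - real q ^ (n - 1)) - (\<Sum>j\<le>c. real (s j))
      = (\<Sum>j\<le>c. ?D j / ?D c * (real q ^ n / real d - real q ^ (n - 1)) - real (s j))"
    by (simp only: \<rho>[symmetric] sum_distrib_right sum_subtractf)
  also have "\<dots> \<le> real ?N"
    unfolding of_nat_sum of_nat_mult by (intro sum_mono summand) auto
  finally have "(\<rho> * (real q ^ n / real d - real q ^ (n - 1)) - (\<Sum>j\<le>c. real (s j))) / real q ^ n \<le> ratio"
    unfolding ratio using q N by (intro divide_right_mono) auto
  moreover have "(\<rho> * (real q ^ n / real d - real q ^ (n - 1)) - (\<Sum>j\<le>c. real (s j))) / real q ^ n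
      = \<rho> * (1 / real d - real q ^ (n - 1) / real q ^ n) - (\<Sum>j\<le>c. real (s j)) / real q ^ n"
    using q by (simp add: field_simps)
  moreover have "(\<Sum>j\<le>c. real (s j)) / real q ^ n \<le> (\<Sum>j\<le>c. real (s j)) / real q"
  proof (rule divide_left_mono)
    show "real q \<le> real q ^ n"
      using n q_pos self_le_power[of "real q" n] by (metis One_nat_def Suc_leI of_nat_1 of_nat_le_iff)
  qed (use q in \<open>auto intro: sum_nonneg\<close>)
  ultimately show "\<rho> * (1 / real d - 1 / real q) - (\<Sum>j\<le>c. real (s j)) / real q \<le> ratio"
    unfolding qn by linarith
qed

end

theorem theorem1p1:
  fixes p n d :: nat
  assumes "prime p" and "CHAR('k::field) = p"
    and perfect: "surj (\<lambda>x::'k. x ^ p)"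
    and "n \<ge> 1" and "d \<ge> 1"
  shows "dual_F_signature (veronese_ring n d :: 'k mpoly ring) p (veronese_canonical_module n d)
           = ereal (1 / real n * of_int \<lceil>real n / real d\<rceil>)"
proof -
  have n: "n > 0" and d: "d > 0" using assms by auto
  obtain c where c: "c < d" "\<And>k. d dvd k + n \<longleftrightarrow> k mod d = c"
    using residue_class_representative[OF d] by metis
  have dvd: "d dvd c + n" using c by simp
  have "\<forall>j\<in>{..c}. \<exists>rsV. fst rsV > 0 \<and>
      surjective_matrix n d j c {..<fst rsV} {..<fst (snd rsV)} (snd (snd rsV) :: nat \<Rightarrow> nat \<Rightarrow> 'k mpoly) \<and>
      card (exponents_of_degree n j) * fst rsV = card (exponents_of_degree n c) * fst (snd rsV)"
  proof
    fix j assume "j \<in> {..c}"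
    then obtain r s and V :: "nat \<Rightarrow> nat \<Rightarrow> 'k mpoly" where "r > 0" "surjective_matrix n d j c {..<r} {..<s} V"
      "card (exponents_of_degree n j) * r = card (exponents_of_degree n c) * s"
      using surjective_matrix_exists[of j c d n] c n by auto
    then show "\<exists>rsV. fst rsV > 0 \<and>
      surjective_matrix n d j c {..<fst rsV} {..<fst (snd rsV)} (snd (snd rsV) :: nat \<Rightarrow> nat \<Rightarrow> 'k mpoly) \<and>
      card (exponents_of_degree n j) * fst rsV = card (exponents_of_degree n c) * fst (snd rsV)"
      by (intro exI[of _ "(r, s, V)"]) simp
  qed
  from bchoice[OF this] obtain rsV where rsV: "\<And>j. j \<le> c \<Longrightarrow> fst (rsV j) > 0"
      "\<And>j. j \<le> c \<Longrightarrow> surjective_matrix n d j c {..<fst (rsV j)} {..<fst (snd (rsV j))}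
        (snd (snd (rsV j)) :: nat \<Rightarrow> nat \<Rightarrow> 'k mpoly)"
      "\<And>j. j \<le> c \<Longrightarrow> card (exponents_of_degree n j) * fst (rsV j)
        = card (exponents_of_degree n c) * fst (snd (rsV j))" by auto
  define ratio where "ratio e =
    real (max_surjection_rank (veronese_ring n d :: 'k mpoly ring)
        (frobenius_pushforward (veronese_ring n d) p e (veronese_canonical_module n d)) (veronese_canonical_module n d))
      / real (module_rank (veronese_ring n d :: 'k mpoly ring)
        (frobenius_pushforward (veronese_ring n d) p e (veronese_canonical_module n d)))" for e
  let ?\<rho> = "real (n + c) / real n"
  let ?s = "\<Sum>j\<le>c. real (fst (snd (rsV j)))"
  have bounds: "?\<rho> * (1 / real d - 1 / real (p ^ e)) - ?s / real (p ^ e) \<le> ratio e"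
    "ratio e \<le> ?\<rho> * (1 / real d + 1 / real (p ^ e))" for e
  proof -
    interpret veronese_frobenius p e n d c "TYPE('k)"
      using assms n d c dvd by unfold_locales auto
    show "?\<rho> * (1 / real d - 1 / real (p ^ e)) - ?s / real (p ^ e) \<le> ratio e"
      "ratio e \<le> ?\<rho> * (1 / real d + 1 / real (p ^ e))"
      unfolding ratio_def
      using surjection_ratio_bounds[of "\<lambda>j. fst (rsV j)" "\<lambda>j. fst (snd (rsV j))" "\<lambda>j. snd (snd (rsV j))", OF rsV(2,1,3)]
      by auto
  qed
  have p: "real p > 1" using prime_gt_1_nat[OF assms(1)] by simp
  have inverse_q: "(\<lambda>e. x / real (p ^ e)) \<longlonglongrightarrow> 0" for x
  proof -
    have "(\<lambda>e. x / real p ^ e) \<longlonglongrightarrow> 0" by (rule LIMSEQ_divide_realpow_zero[OF p])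
    then show ?thesis by simp
  qed
  have lower: "(\<lambda>e. ?\<rho> * (1 / real d - 1 / real (p ^ e)) - ?s / real (p ^ e)) \<longlonglongrightarrow> ?\<rho> * (1 / real d - 0) - 0"
    by (intro tendsto_intros inverse_q)
  have upper: "(\<lambda>e. ?\<rho> * (1 / real d + 1 / real (p ^ e))) \<longlonglongrightarrow> ?\<rho> * (1 / real d + 0)"
    by (intro tendsto_intros inverse_q)
  have "ratio \<longlonglongrightarrow> ?\<rho> * (1 / real d)"
    using tendsto_sandwich[OF always_eventually[OF allI] always_eventually[OF allI], OF bounds]
      lower upper by simp
  then have "(\<lambda>e. ereal (ratio e)) \<longlonglongrightarrow> ereal (?\<rho> * (1 / real d))" by simp
  then have "limsup (\<lambda>e. ereal (ratio e)) = ereal (?\<rho> * (1 / real d))"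
    by (intro lim_imp_Limsup) simp_all
  moreover have "?\<rho> * (1 / real d) = 1 / real n * of_int \<lceil>real n / real d\<rceil>"
  proof -
    obtain t where t: "c + n = d * t" using dvd by blast
    have tr: "real c + real n = real d * real t" using arg_cong[OF t, of real] by simp
    have "\<lceil>real n / real d\<rceil> = int t"
    proof (rule ceiling_unique)
      have "real d * real t < real d + real n" using tr c by simp
      then show "real_of_int (int t) - 1 < real n / real d" using d by (simp add: field_simps)
      have "real n \<le> real d * real t" using tr by simp
      then show "real n / real d \<le> real_of_int (int t)" using d by (simp add: field_simps)
    qed
    moreover have "real (n + c) = real d * real t" using tr by simp
    ultimately show ?thesis using d n by simp
  qed
  ultimately show ?thesis unfolding dual_F_signature_def ratio_def by simp
qed

end
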